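(* Fix $k\in\{1,2,\dots\}\cup\{\infty\}$. Let $\mathcal{S}$ range over $C^k$-structures on the line with two origins $\mathbb{L}$. Then: (1) the assignment $[\mathcal{S}]\mapsto D^k(\mathbb{R},0)\,\gamma_{\mathcal{A}}\,D^k(\mathbb{R},0)\cup D^k(\mathbb{R},0)\,\gamma_{\mathcal{A}}^{-1}\,D^k(\mathbb{R},0)$, where $\mathcal{A}\in\mathcal{S}$ is any minimal atlas and $\gamma_{\mathcal{A}}$ is the $0$-extension of its transition map, is a well-defined bijection from the set of $C^k$-structures on $\mathbb{L}$ modulo $C^k$-diffeomorphism onto the set $D^k(\mathbb{R},0)\backslash\!\backslash^{\pm} H^k(\mathbb{R},0)$ of $(D^k(\mathbb{R},0),\pm)$-double cosets in $H^k(\mathbb{R},0)$; (2) the assignment $[\mathcal{S}]^{\mathrm{fix}}\mapsto D^k(\mathbb{R},0)\,\gamma_{\mathcal{A}}\,D^k(\mathbb{R},0)$, with $\mathcal{A}\in\mathcal{S}$ any minimal atlas, is a well-defined bijection from the set of $C^k$-structures on $\mathbb{L}$ modulo $C^k$-diffeomorphisms fixing both $0$ and $0'$ onto the set $D^k(\mathbb{R},0)\backslash H^k(\mathbb{R},0)/D^k(\mathbb{R},0)$ of $D^k(\mathbb{R},0)$-double cosets in $H^k(\mathbb{R},0)$.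
   Context: The line with two origins $\mathbb{L}$ is the set $\mathbb{R}\sqcup\{0'\}$ whose open sets are the open subsets of $\mathbb{R}$ together with all sets $(W\setminus\{0\})\cup\{0'\}$ with $W\subset\mathbb{R}$ open and $0\in W$. Put $U=\mathbb{L}\setminus\{0'\}=\mathbb{R}$ and $V=\mathbb{L}\setminus\{0\}=(\mathbb{R}\setminus\{0\})\cup\{0'\}$. A chart is a homeomorphism of an open subset of $\mathbb{L}$ onto an open subset of $\mathbb{R}$; two charts are $C^k$-compatible if their domains are disjoint or the transition map between them is a $C^k$-diffeomorphism; a $C^k$-atlas is a family of pairwise compatible charts covering $\mathbb{L}$; a $C^k$-structure is an equivalence class of $C^k$-atlases, two atlases being equivalent if their union is a $C^k$-atlas. A $C^k$-diffeomorphism between structures is a homeomorphism which, together with its inverse, is $C^k$ in local charts of the structures. Every homeomorphism of $\mathbb{L}$ either fixes both $0,0'$ or exchanges them. $H^k(\mathbb{R},0)$ is the group of homeomorphisms $h$ of $\mathbb{R}$ with $h(0)=0$ whose restriction to $\mathbb{R}\setminus\{0\}$ is a $C^k$-diffeomorphism of $\mathbb{R}\setminus\{0\}$; $D^k(\mathbb{R},0)\subset H^k(\mathbb{R},0)$ is the subgroup of $C^k$-diffeomorphisms of $\mathbb{R}$ fixing $0$. The $D^k(\mathbb{R},0)$-double coset of $h$ is $\{ahb: a,b\in D^k(\mathbb{R},0)\}$, and the $(D^k(\mathbb{R},0),\pm)$-double coset of $h$ is the union of the double cosets of $h$ and $h^{-1}$. A minimal atlas is a $C^k$-atlas $\{(U,\varphi),(V,\psi)\}$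 with $\varphi\colon U\to\mathbb{R}$, $\psi\colon V\to\mathbb{R}$ homeomorphisms onto $\mathbb{R}$ and $\varphi(0)=\psi(0')=0$; its transition map $\psi\circ\varphi^{-1}\colon\mathbb{R}\setminus\{0\}\to\mathbb{R}\setminus\{0\}$ has a unique extension $\gamma_{\mathcal{A}}\in H^k(\mathbb{R},0)$ with $\gamma_{\mathcal{A}}(0)=0$, called its $0$-extension. Every $C^k$-structure on $\mathbb{L}$ contains minimal atlases. *)

theory Defs
  imports "HOL-Analysis.Analysis" "HOL-Library.Extended_Nat"
begin

text \<open>The line with two origins is modelled as the type real option:
  Some x is the point x of the real line (Some 0 is the origin 0),
  None is the second origin 0'.\<close>

definition orig :: "real option" where "orig = Some 0"
definition orig' :: "real option" where "orig' = None"

definition jL :: "real \<Rightarrow> real option" where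
  "jL x = (if x = 0 then None else Some x)"

text \<open>A set is open iff its preimages under both inclusions of the real line are open
  (the topology generated by the open sets listed in the paper).\<close>
definition openL :: "real option set \<Rightarrow> bool" where
  "openL S \<longleftrightarrow> open (Some -` S) \<and> open (jL -` S)"

definition TL :: "real option topology" where
  "TL = topology openL"

definition UL :: "real option set" where "UL = range Some"
definition VL :: "real option set" where "VL = - {Some 0}"

definition Ck_on :: "enat \<Rightarrow> real set \<Rightarrow> (real \<Rightarrow> real) \<Rightarrow> bool" where
  "Ck_on k S f \<longleftrightarrow> (\<exists>D :: nat \<Rightarrow> real \<Rightarrow> real.
      (\<forall>x\<in>S. D 0 x = f x) \<and>
      (\<forall>n. enat n < k \<longrightarrow> (\<forall>x\<in>S. (D n has_real_derivative D (Suc n) x) (at x))) \<and>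
      (\<forall>n. enat n \<le> k \<longrightarrow> continuous_on S (D n)))"

definition Ck_diffeo :: "enat \<Rightarrow> real set \<Rightarrow> real set \<Rightarrow> (real \<Rightarrow> real) \<Rightarrow> bool" where
  "Ck_diffeo k A B f \<longleftrightarrow> bij_betw f A B \<and> Ck_on k A f \<and> Ck_on k B (inv_into A f)"

type_synonym chart = "real option set \<times> (real option \<Rightarrow> real)"

definition is_chart :: "chart \<Rightarrow> bool" where
  "is_chart c \<longleftrightarrow> (case c of (D, \<phi>) \<Rightarrow>
      openL D \<and> open (\<phi> ` D) \<and>
      homeomorphic_map (subtopology TL D) (subtopology euclideanreal (\<phi> ` D)) \<phi>)"

definition compatible :: "enat \<Rightarrow> chart \<Rightarrow> chart \<Rightarrow> bool" where
  "compatible k c1 c2 \<longleftrightarrow> (case c1 of (D1, \<phi>1) \<Rightarrow> case c2 of (D2, \<phi>2) \<Rightarrow>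
      D1 \<inter> D2 = {} \<or>
      Ck_diffeo k (\<phi>1 ` (D1 \<inter> D2)) (\<phi>2 ` (D1 \<inter> D2)) (\<phi>2 \<circ> inv_into D1 \<phi>1))"

definition is_atlas :: "enat \<Rightarrow> chart set \<Rightarrow> bool" where
  "is_atlas k A \<longleftrightarrow> (\<forall>c\<in>A. is_chart c) \<and> (\<forall>c1\<in>A. \<forall>c2\<in>A. compatible k c1 c2)
      \<and> (\<Union>c\<in>A. fst c) = UNIV"

definition is_structure :: "enat \<Rightarrow> chart set set \<Rightarrow> bool" where
  "is_structure k S \<longleftrightarrow> (\<exists>A. is_atlas k A \<and>
      S = {B. is_atlas k B \<and> is_atlas k (A \<union> B)})"

definition Ck_map :: "enat \<Rightarrow> chart set set \<Rightarrow> chart set set \<Rightarrow> (real option \<Rightarrow> real option) \<Rightarrow> bool" where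
  "Ck_map k S1 S2 f \<longleftrightarrow> (\<forall>(D, \<phi>)\<in>\<Union>S1. \<forall>(E, \<psi>)\<in>\<Union>S2.
      Ck_on k (\<phi> ` (D \<inter> f -` E)) (\<psi> \<circ> f \<circ> inv_into D \<phi>))"

definition Ck_diffeo_L :: "enat \<Rightarrow> chart set set \<Rightarrow> chart set set \<Rightarrow> (real option \<Rightarrow> real option) \<Rightarrow> bool" where
  "Ck_diffeo_L k S1 S2 h \<longleftrightarrow> homeomorphic_map TL TL h \<and> Ck_map k S1 S2 h \<and> Ck_map k S2 S1 (inv h)"

definition diffeomorphic :: "enat \<Rightarrow> chart set set \<Rightarrow> chart set set \<Rightarrow> bool" where
  "diffeomorphic k S1 S2 \<longleftrightarrow> (\<exists>h. Ck_diffeo_L k S1 S2 h)"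

definition diffeomorphic_fix :: "enat \<Rightarrow> chart set set \<Rightarrow> chart set set \<Rightarrow> bool" where
  "diffeomorphic_fix k S1 S2 \<longleftrightarrow>
     (\<exists>h. Ck_diffeo_L k S1 S2 h \<and> h orig = orig \<and> h orig' = orig')"

definition Hk :: "enat \<Rightarrow> (real \<Rightarrow> real) set" where
  "Hk k = {h. (\<exists>g. homeomorphism UNIV UNIV h g) \<and> h 0 = 0 \<and> Ck_diffeo k (- {0}) (- {0}) h}"

definition Dk :: "enat \<Rightarrow> (real \<Rightarrow> real) set" where
  "Dk k = {h. Ck_diffeo k UNIV UNIV h \<and> h 0 = 0}"

definition dcoset :: "enat \<Rightarrow> (real \<Rightarrow> real) \<Rightarrow> (real \<Rightarrow> real) set" where
  "dcoset k h = {a \<circ> h \<circ> b | a b. a \<in> Dk k \<and> b \<in> Dk k}"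

definition pm_dcoset :: "enat \<Rightarrow> (real \<Rightarrow> real) \<Rightarrow> (real \<Rightarrow> real) set" where
  "pm_dcoset k h = dcoset k h \<union> dcoset k (inv h)"

definition minimal_atlas :: "enat \<Rightarrow> (real option \<Rightarrow> real) \<Rightarrow> (real option \<Rightarrow> real) \<Rightarrow> bool" where
  "minimal_atlas k \<phi> \<psi> \<longleftrightarrow> is_atlas k {(UL, \<phi>), (VL, \<psi>)} \<and>
      \<phi> ` UL = UNIV \<and> \<psi> ` VL = UNIV \<and> \<phi> orig = 0 \<and> \<psi> orig' = 0"

definition gamma :: "(real option \<Rightarrow> real) \<Rightarrow> (real option \<Rightarrow> real) \<Rightarrow> real \<Rightarrow> real" where
  "gamma \<phi> \<psi> x = (if x = 0 then 0 else \<psi> (inv_into UL \<phi> x))"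

end

theory Submission
  imports Defs
begin

text \<open>Through the parametrisations of the two lines, a minimal atlas is a pair \<open>P, Q\<close> of
  homeomorphisms of the real line fixing 0, and the 0-extension of its transition map is
  \<open>Q \<circ> P\<^sup>-\<^sup>1\<close>. The two origins are the only pair of points
  without disjoint neighbourhoods, so every homeomorphism of the line with two origins is given by one
  homeomorphism \<open>\<eta>\<close> of the real line fixing 0, together with the choice of fixing or exchanging the
  origins. It is a diffeomorphism iff \<open>P2 \<circ> \<eta> \<circ> P1\<^sup>-\<^sup>1\<close> and \<open>Q2 \<circ> \<eta> \<circ> Q1\<^sup>-\<^sup>1\<close> (with \<open>P2\<close> and \<open>Q2\<close> interchanged in the
  second case) lie in \<open>D^k\<close>; eliminating \<open>\<eta>\<close> gives the double coset condition.

  That minimal atlases exist amounts to the fact that every \<open>C^k\<close> atlas of the real line admits a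
  compatible chart defined on the whole line. Such a chart is a locally finite sum of step functions, each of which is a
  smooth step function composed with a single increasing chart and continued by constants.\<close>

section \<open>Calculus of \<open>C^k\<close> functions\<close>

text \<open>Charts cannot be glued by averaging, but monotone functions can be added: being
  nondecreasing in every chart survives sums, and positivity of the derivative at a point survives
  as soon as one summand has it. This forces all charts to be oriented alike, so decreasing ones are
  multiplied by -1. It also forces control of derivatives instead of mere strict monotonicity: x^3
  is a smooth homeomorphism of the line whose inverse is not smooth. The condition k \<ge> 1
  provides these derivatives. The elimination of \<eta> is short: P2 \<eta> P1^-1 = c^-1 and Q2
  \<eta> Q1^-1 = a give Q2 P2^-1 = a (Q1 P1^-1) c. Interchanging P2 and Q2 inverts the left side,
  which is the source of the double coset of the inverse in (1).\<close>

lemma Ck_on_cong: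
  assumes "\<And>x. x \<in> S \<Longrightarrow> f x = g x"
  shows "Ck_on k S f \<longleftrightarrow> Ck_on k S g"
  using assms unfolding Ck_on_def by simp

lemma Ck_on_eq:
  assumes "Ck_on k S f" "\<And>x. x \<in> S \<Longrightarrow> f x = g x"
  shows "Ck_on k S g"
  using assms Ck_on_cong[of S f g] by simp

lemma Ck_on_le: "Ck_on k S f \<Longrightarrow> l \<le> k \<Longrightarrow> Ck_on l S f"
  unfolding Ck_on_def by (elim ex_forward conj_forward all_forward imp_forward) auto

lemma Ck_on_subset: "Ck_on k S f \<Longrightarrow> T \<subseteq> S \<Longrightarrow> Ck_on k T f"
  unfolding Ck_on_def
  by (elim ex_forward conj_forward all_forward imp_forward) (auto intro: continuous_on_subset)

lemma Ck_on_zero: "Ck_on 0 S f \<longleftrightarrow> continuous_on S f"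
proof
  assume "Ck_on 0 S f"
  then obtain D :: "nat \<Rightarrow> real \<Rightarrow> real" where "\<forall>x\<in>S. D 0 x = f x" "continuous_on S (D 0)"
    unfolding Ck_on_def by (auto simp: zero_enat_def)
  then show "continuous_on S f"
    by (metis continuous_on_cong)
next
  assume "continuous_on S f"
  then show "Ck_on 0 S f"
    unfolding Ck_on_def by (intro exI[of _ "\<lambda>_. f"]) (auto simp: zero_enat_def)
qed

lemma Ck_on_imp_continuous: "Ck_on k S f \<Longrightarrow> continuous_on S f"
  using Ck_on_le[of k S f 0] by (simp add: Ck_on_zero)

text \<open>The inductions on the order of differentiability run through this recursion. Openness
  lets the derivative of \<open>D 0\<close>, which agrees with \<open>f\<close> only on
  \<open>S\<close>, pass to \<open>f\<close> itself.\<close>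

lemma Ck_on_Suc:
  assumes "open S"
  shows "Ck_on (enat (Suc n)) S f \<longleftrightarrow>
    (\<exists>f'. (\<forall>x\<in>S. (f has_real_derivative f' x) (at x)) \<and> Ck_on (enat n) S f')"
proof
  assume "Ck_on (enat (Suc n)) S f"
  then obtain D :: "nat \<Rightarrow> real \<Rightarrow> real" where D: "\<forall>x\<in>S. D 0 x = f x"
    "\<forall>m. enat m < enat (Suc n) \<longrightarrow> (\<forall>x\<in>S. (D m has_real_derivative D (Suc m) x) (at x))"
    "\<forall>m. enat m \<le> enat (Suc n) \<longrightarrow> continuous_on S (D m)"
    unfolding Ck_on_def by blast
  have "(f has_real_derivative D 1 x) (at x)" if "x \<in> S" for x
    using has_field_derivative_transform_within_open[OF _ assms that, of "D 0" "D 1 x" f] D(1,2) that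
    by auto
  moreover have "Ck_on (enat n) S (D 1)"
    unfolding Ck_on_def using D by (intro exI[of _ "\<lambda>m. D (Suc m)"]) auto
  ultimately show "\<exists>f'. (\<forall>x\<in>S. (f has_real_derivative f' x) (at x)) \<and> Ck_on (enat n) S f'"
    by blast
next
  assume "\<exists>f'. (\<forall>x\<in>S. (f has_real_derivative f' x) (at x)) \<and> Ck_on (enat n) S f'"
  then obtain f' D where f': "\<forall>x\<in>S. (f has_real_derivative f' x) (at x)" and D: "\<forall>x\<in>S. D 0 x = f' x"
    "\<forall>m. enat m < enat n \<longrightarrow> (\<forall>x\<in>S. (D m has_real_derivative D (Suc m) x) (at x))"
    "\<forall>m. enat m \<le> enat n \<longrightarrow> continuous_on S (D m)"
    unfolding Ck_on_def by blast
  have c: "continuous_on S f"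
    using f' by (meson DERIV_isCont continuous_at_imp_continuous_on)
  show "Ck_on (enat (Suc n)) S f"
    unfolding Ck_on_def
  proof (intro exI[of _ "case_nat f D"] conjI allI impI ballI)
    fix m x assume "enat m < enat (Suc n)" "x \<in> S"
    then show "(case_nat f D m has_real_derivative case_nat f D (Suc m) x) (at x)"
      using f' D by (cases m) auto
  next
    fix m assume "enat m \<le> enat (Suc n)"
    then show "continuous_on S (case_nat f D m)"
      using c D(3) by (cases m) auto
  qed auto
qed

lemma Ck_on_SucI:
  assumes "open S" "\<And>x. x \<in> S \<Longrightarrow> (f has_real_derivative f' x) (at x)" "Ck_on (enat n) S f'"
  shows "Ck_on (enat (Suc n)) S f"
  unfolding Ck_on_Suc[OF assms(1)] using assms(2,3) by (intro exI[of _ f']) simp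

lemma Ck_on_Suc_deriv:
  assumes "open S"
  shows "Ck_on (enat (Suc n)) S f \<longleftrightarrow>
    (\<forall>x\<in>S. (f has_real_derivative deriv f x) (at x)) \<and> Ck_on (enat n) S (deriv f)"
proof
  assume "Ck_on (enat (Suc n)) S f"
  then obtain f' where f': "\<forall>x\<in>S. (f has_real_derivative f' x) (at x)" "Ck_on (enat n) S f'"
    using Ck_on_Suc[OF assms] by blast
  then have "\<And>x. x \<in> S \<Longrightarrow> deriv f x = f' x"
    by (simp add: DERIV_imp_deriv)
  with f' show "(\<forall>x\<in>S. (f has_real_derivative deriv f x) (at x)) \<and> Ck_on (enat n) S (deriv f)"
    using Ck_on_cong[of S "deriv f" f'] by auto
qed (use Ck_on_Suc[OF assms] in blast)

lemma Ck_on_iterated_deriv: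
  assumes "open S"
  shows "Ck_on (enat (Suc n)) S f \<Longrightarrow>
    (\<forall>x\<in>S. ((deriv ^^ n) f has_real_derivative (deriv ^^ Suc n) f x) (at x))"
proof (induction n arbitrary: f)
  case (Suc n)
  then have "Ck_on (enat (Suc n)) S (deriv f)"
    using Ck_on_Suc_deriv[OF assms] by blast
  from Suc.IH[OF this] show ?case
    by (simp add: funpow_swap1)
qed (simp add: Ck_on_Suc_deriv[OF assms])

text \<open>For k = \<infinity> the witnesses of the finite orders could be unrelated sequences; the
  iterates of \<open>deriv\<close> form one sequence that serves all orders at once. Claims for
  general \<open>k\<close> thereby reduce to induction over natural numbers.\<close>

lemma Ck_on_finiteI:
  assumes "open S" and *: "\<And>n. enat n \<le> k \<Longrightarrow> Ck_on (enat n) S f"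
  shows "Ck_on k S f"
proof (cases k)
  case (enat n)
  with * show ?thesis by auto
next
  case infinity
  with * have d: "(\<forall>x\<in>S. ((deriv ^^ n) f has_real_derivative (deriv ^^ Suc n) f x) (at x))" for n
    by (intro Ck_on_iterated_deriv[OF assms(1)]) simp
  then have "continuous_on S ((deriv ^^ n) f)" for n
    by (meson DERIV_isCont continuous_at_imp_continuous_on)
  with d show ?thesis
    unfolding Ck_on_def by (intro exI[of _ "\<lambda>n. (deriv ^^ n) f"]) auto
qed

text \<open>Local derivative sequences need not agree with one another, but \<open>deriv f\<close>
  is one global function, to which the induction hypothesis applies.\<close>

lemma Ck_on_local:
  assumes "\<And>x. x \<in> S \<Longrightarrow> \<exists>T. open T \<and> x \<in> T \<and> Ck_on k T f" and "open S"
  shows "Ck_on k S f"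
proof -
  have fin: "Ck_on (enat n) S f"
    if "\<And>x. x \<in> S \<Longrightarrow> \<exists>T. open T \<and> x \<in> T \<and> Ck_on (enat n) T f" for n f
    using that
  proof (induction n arbitrary: f)
    case 0
    then have "\<exists>T. open T \<and> x \<in> T \<and> continuous_on T f" if "x \<in> S" for x
      using that by (metis Ck_on_zero zero_enat_def)
    then have "isCont f x" if "x \<in> S" for x
      using that by (meson continuous_on_eq_continuous_at)
    then show ?case
      by (metis Ck_on_zero zero_enat_def continuous_at_imp_continuous_on)
  next
    case (Suc n)
    have "\<exists>T. open T \<and> x \<in> T \<and> (\<forall>x\<in>T. (f has_real_derivative deriv f x) (at x)) \<and> Ck_on (enat n) T (deriv f)"
      if "x \<in> S" for x
      using Suc.prems[OF that] Ck_on_Suc_deriv by blast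
    then show ?case
      using Suc.IH[of "deriv f"] Ck_on_Suc_deriv[OF assms(2)] by blast
  qed
  show ?thesis
    by (rule Ck_on_finiteI[OF assms(2)], rule fin) (metis assms(1) Ck_on_le)
qed

section \<open>Closure properties of C^k functions\<close>

lemma Ck_on_const: "Ck_on k S (\<lambda>x. c)"
  unfolding Ck_on_def by (intro exI[of _ "\<lambda>n x. if n = 0 then c else 0"]) auto

lemma Ck_on_id: "Ck_on k S (\<lambda>x. x)"
  unfolding Ck_on_def
proof (intro exI[of _ "\<lambda>n x. if n = 0 then x else if n = 1 then 1 else 0"] conjI allI impI ballI)
  fix n x
  show "((\<lambda>x. if n = 0 then x else if n = 1 then 1 else 0) has_real_derivative
     (if Suc n = 0 then x else if Suc n = 1 then 1 else 0)) (at x)"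
    by (cases "n = 0") (auto intro!: derivative_eq_intros)
next
  fix n show "continuous_on S (\<lambda>x. if n = 0 then x else if n = 1 then 1 else 0::real)"
    by (cases "n = 0") auto
qed auto

lemma Ck_on_add:
  assumes S: "open S" and "Ck_on k S f" "Ck_on k S g"
  shows "Ck_on k S (\<lambda>x. f x + g x)"
proof -
  have step: "Ck_on (enat n) S f \<Longrightarrow> Ck_on (enat n) S g \<Longrightarrow> Ck_on (enat n) S (\<lambda>x. f x + g x)" for n f g
  proof (induction n arbitrary: f g)
    case 0
    then show ?case
      by (metis Ck_on_zero zero_enat_def continuous_on_add)
  next
    case (Suc n)
    then obtain f' g' where "\<forall>x\<in>S. (f has_real_derivative f' x) (at x)" "Ck_on (enat n) S f'"
       "\<forall>x\<in>S. (g has_real_derivative g' x) (at x)" "Ck_on (enat n) S g'"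
      unfolding Ck_on_Suc[OF S] by blast
    with Suc.IH show ?case
      unfolding Ck_on_Suc[OF S]
      by (intro exI[of _ "\<lambda>x. f' x + g' x"]) (auto intro: DERIV_add)
  qed
  show ?thesis
    by (rule Ck_on_finiteI[OF S], rule step) (rule Ck_on_le[of k], simp_all add: assms)+
qed

lemma Ck_on_mult:
  assumes S: "open S" and "Ck_on k S f" "Ck_on k S g"
  shows "Ck_on k S (\<lambda>x. f x * g x)"
proof -
  have step: "Ck_on (enat n) S f \<Longrightarrow> Ck_on (enat n) S g \<Longrightarrow> Ck_on (enat n) S (\<lambda>x. f x * g x)" for n f g
  proof (induction n arbitrary: f g)
    case 0
    then show ?case
      by (metis Ck_on_zero zero_enat_def continuous_on_mult)
  next
    case (Suc n)
    then obtain f' g' where *: "\<forall>x\<in>S. (f has_real_derivative f' x) (at x)" "Ck_on (enat n) S f'"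
       "\<forall>x\<in>S. (g has_real_derivative g' x) (at x)" "Ck_on (enat n) S g'"
      unfolding Ck_on_Suc[OF S] by blast
    have "Ck_on (enat n) S f" "Ck_on (enat n) S g"
      using Suc.prems by (auto elim!: Ck_on_le)
    with * Suc.IH show ?case
      unfolding Ck_on_Suc[OF S]
      by (intro exI[of _ "\<lambda>x. f' x * g x + g' x * f x"])
         (auto intro: DERIV_mult Ck_on_add[OF S])
  qed
  show ?thesis
    by (rule Ck_on_finiteI[OF S], rule step) (rule Ck_on_le[of k], simp_all add: assms)+
qed

lemma Ck_on_compose:
  assumes S: "open S" and T: "open T" and sub: "f ` S \<subseteq> T" and "Ck_on k S f" "Ck_on k T g"
  shows "Ck_on k S (g \<circ> f)"
proof -
  have step: "Ck_on (enat n) S f \<Longrightarrow> Ck_on (enat n) T g \<Longrightarrow> Ck_on (enat n) S (g \<circ> f)" for n g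
  proof (induction n arbitrary: g)
    case 0
    then show ?case
      using sub by (metis Ck_on_zero zero_enat_def continuous_on_compose continuous_on_subset)
  next
    case (Suc n)
    then obtain f' g' where *: "\<forall>x\<in>S. (f has_real_derivative f' x) (at x)" "Ck_on (enat n) S f'"
       "\<forall>x\<in>T. (g has_real_derivative g' x) (at x)" "Ck_on (enat n) T g'"
      unfolding Ck_on_Suc[OF S] Ck_on_Suc[OF T] by blast
    have "Ck_on (enat n) S f"
      using Suc.prems by (auto elim!: Ck_on_le)
    with * Suc.IH have "Ck_on (enat n) S (\<lambda>x. (g' \<circ> f) x * f' x)"
      by (intro Ck_on_mult[OF S])
    moreover have "((g \<circ> f) has_real_derivative (g' \<circ> f) x * f' x) (at x)" if "x \<in> S" for x
      using * sub that by (auto intro!: DERIV_chain)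
    ultimately show ?case
      by (intro Ck_on_SucI[OF S])
  qed
  show ?thesis
    by (rule Ck_on_finiteI[OF S], rule step) (rule Ck_on_le[of k], simp_all add: assms)+
qed

lemma Ck_on_inverse:
  assumes S: "open S" and "Ck_on k S f" and nz: "\<And>x. x \<in> S \<Longrightarrow> f x \<noteq> 0"
  shows "Ck_on k S (\<lambda>x. inverse (f x))"
proof -
  have step: "Ck_on (enat n) S f \<Longrightarrow> Ck_on (enat n) S (\<lambda>x. inverse (f x))" for n
  proof (induction n)
    case 0
    then show ?case
      using nz by (metis Ck_on_zero zero_enat_def continuous_on_inverse)
  next
    case (Suc n)
    then obtain f' where *: "\<forall>x\<in>S. (f has_real_derivative f' x) (at x)" "Ck_on (enat n) S f'"
      unfolding Ck_on_Suc[OF S] by blast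
    have "Ck_on (enat n) S (\<lambda>x. inverse (f x))"
      using Suc.prems by (intro Suc.IH) (auto elim!: Ck_on_le)
    then have "Ck_on (enat n) S (\<lambda>x. (-1) * (inverse (f x) * (f' x * inverse (f x))))"
      using * by (intro Ck_on_mult[OF S] Ck_on_const)
    moreover have "((\<lambda>x. inverse (f x)) has_real_derivative (-1) * (inverse (f x) * (f' x * inverse (f x)))) (at x)"
      if "x \<in> S" for x
      using * nz that by (auto intro!: derivative_eq_intros)
    ultimately show ?case
      by (intro Ck_on_SucI[OF S])
  qed
  show ?thesis
    by (rule Ck_on_finiteI[OF S], rule step) (rule Ck_on_le[of k], simp_all add: assms)+
qed

lemma Ck_on_imp_has_derivative:
  assumes "open S" "k \<ge> 1" "Ck_on k S f" "x \<in> S"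
  shows "(f has_real_derivative deriv f x) (at x)"
proof -
  have "Ck_on (enat (Suc 0)) S f"
    using assms Ck_on_le by (simp add: one_enat_def)
  with assms show ?thesis
    using Ck_on_Suc_deriv by blast
qed

text \<open>Bootstrapping: the derivative of the inverse is
  \<open>inverse (deriv f (inv_into S f y))\<close>. If the inverse and \<open>deriv f\<close> are
  C^n, so is this expression, and the inverse gains one order.\<close>

lemma Ck_on_inv_into:
  assumes S: "open S" and "k \<ge> 1" and "Ck_on k S f" and inj: "inj_on f S"
    and nz: "\<And>x. x \<in> S \<Longrightarrow> deriv f x \<noteq> 0"
  shows "open (f ` S)" "Ck_on k (f ` S) (inv_into S f)"
proof -
  have cont: "continuous_on S f"
    using assms Ck_on_imp_continuous by blast
  show opn: "open (f ` S)"
    using invariance_of_domain[OF cont S inj] .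
  have d: "(inv_into S f has_real_derivative inverse (deriv f (inv_into S f y))) (at y)" if "y \<in> f ` S" for y
  proof -
    from that obtain x where x: "x \<in> S" "y = f x" by blast
    have "(inv_into S f has_real_derivative inverse (deriv f x)) (at (f x))"
      using Ck_on_imp_has_derivative[OF S assms(2,3) x(1)] x inj nz
      unfolding has_field_derivative_def
      by (intro has_derivative_inverse_strong[OF S _ cont]) auto
    with x inj show ?thesis by simp
  qed
  then have ci: "continuous_on (f ` S) (inv_into S f)"
    by (meson DERIV_isCont continuous_at_imp_continuous_on)
  have step: "Ck_on (enat n) S f \<Longrightarrow> Ck_on (enat n) (f ` S) (inv_into S f)" for n
  proof (induction n)
    case 0
    show ?case using ci by (metis Ck_on_zero zero_enat_def)
  next
    case (Suc n)
    then have f': "Ck_on (enat n) S (deriv f)"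
      using Ck_on_Suc_deriv[OF S] by blast
    have "Ck_on (enat n) S f"
      using Suc.prems by (auto elim!: Ck_on_le)
    then have "Ck_on (enat n) (f ` S) ((\<lambda>x. inverse (deriv f x)) \<circ> inv_into S f)"
      using Suc.IH f' nz by (intro Ck_on_compose[OF opn S] Ck_on_inverse[OF S]) (auto intro: inv_into_into)
    with d show ?case
      by (intro Ck_on_SucI[OF opn]) (auto simp: comp_def)
  qed
  show "Ck_on k (f ` S) (inv_into S f)"
    by (rule Ck_on_finiteI[OF opn], rule step) (rule Ck_on_le[of k], simp_all add: assms)
qed

section \<open>A smooth step function\<close>

text \<open>The functions \<open>flat p\<close> are closed under differentiation, which gives smoothness at 0 at once.\<close>

definition flat :: "real poly \<Rightarrow> real \<Rightarrow> real" where
  "flat p x = (if x > 0 then poly p (1 / x) * exp (- (1 / x)) else 0)"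

lemma poly_times_exp_minus_tendsto_0:
  "((\<lambda>y. poly p y * exp (- y)) \<longlongrightarrow> 0) at_top" for p :: "real poly"
proof -
  have "((\<lambda>y. \<Sum>i\<le>degree p. coeff p i * (y ^ i / exp y)) \<longlongrightarrow> (\<Sum>i\<le>degree p. coeff p i * 0)) at_top"
    by (intro tendsto_sum tendsto_mult tendsto_const tendsto_power_div_exp_0)
  then show ?thesis
    by (simp add: poly_altdef sum_divide_distrib exp_minus field_simps)
qed

text \<open>With y = 1/x one has dy/dx = -y^2, so p(y) e^(-y) has x-derivative y^2 (p - p')(y)
  e^(-y); the polynomial \<open>[:0, 0, 1:]\<close> is y^2.\<close>

lemma flat_has_derivative:
  "(flat p has_real_derivative flat ([:0, 0, 1:] * (p - pderiv p)) x) (at x)"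
proof -
  consider "x > 0" | "x < 0" | "x = 0" by linarith
  then show ?thesis
  proof cases
    case 1
    have "((\<lambda>x. poly p (1 / x) * exp (- (1 / x))) has_real_derivative
       flat ([:0, 0, 1:] * (p - pderiv p)) x) (at x)"
      using 1 by (auto intro!: derivative_eq_intros DERIV_chain2[OF poly_DERIV] simp: flat_def field_simps power2_eq_square)
    then show ?thesis
      by (rule has_field_derivative_transform_within_open[where S="{0<..}"]) (use 1 in \<open>auto simp: flat_def\<close>)
  next
    case 2
    have "((\<lambda>x. 0) has_real_derivative flat ([:0, 0, 1:] * (p - pderiv p)) x) (at x)"
      using 2 by (auto simp: flat_def)
    then show ?thesis
      by (rule has_field_derivative_transform_within_open[where S="{..<0}"]) (use 2 in \<open>auto simp: flat_def\<close>)
  next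
    case 3
    \<comment> \<open>The difference quotient at 0 divides by \<open>y\<close>, which multiplies the
      polynomial in 1/y by one more factor 1/y.\<close>
    have "((\<lambda>y. poly ([:0, 1:] * p) (inverse y) * exp (- inverse y)) \<longlongrightarrow> 0) (at_right 0)"
      by (rule filterlim_compose[OF poly_times_exp_minus_tendsto_0 filterlim_inverse_at_top_right])
    moreover have "\<forall>\<^sub>F y in at_right 0. poly ([:0, 1:] * p) (inverse y) * exp (- inverse y) = flat p y / y"
      by (rule eventually_mono[OF eventually_at_right_less[of "0::real"]]) (simp add: flat_def field_simps)
    ultimately have "((\<lambda>y. flat p y / y) \<longlongrightarrow> 0) (at_right 0)"
      using tendsto_cong by fastforce
    moreover have "((\<lambda>y. flat p y / y) \<longlongrightarrow> 0) (at_left 0)"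
      by (rule tendsto_eventually, rule eventually_mono[OF eventually_at_left_real[of "-1" 0]])
         (auto simp: flat_def)
    ultimately have "((\<lambda>y. flat p y / y) \<longlongrightarrow> 0) (at 0)"
      using filterlim_split_at by blast
    then show ?thesis
      using 3 by (simp add: has_field_derivative_iff flat_def)
  qed
qed

lemma Ck_on_flat: "Ck_on k S (flat p)"
  unfolding Ck_on_def
proof (intro exI[of _ "\<lambda>n. flat (((\<lambda>p. [:0, 0, 1:] * (p - pderiv p)) ^^ n) p)"] conjI allI impI ballI)
  fix n
  show "continuous_on S (flat (((\<lambda>p. [:0, 0, 1:] * (p - pderiv p)) ^^ n) p))"
    by (meson flat_has_derivative DERIV_isCont continuous_at_imp_continuous_on)
qed (use flat_has_derivative in auto)

text \<open>The quotient A/(A + B), where A continues e^(-1/(x - a)) and B continues e^(-1/(b - x))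
  by 0; since a < b, the two never vanish together. The explicit \<open>s'\<close> is carried along
  because later arguments need a positive derivative.\<close>

lemma smooth_step_exists:
  fixes a b :: real
  assumes "a < b"
  obtains s s' where "\<And>k. Ck_on k UNIV s" "\<And>x. (s has_real_derivative s' x) (at x)"
    "\<And>x. s' x \<ge> 0" "\<And>x. x \<in> {a<..<b} \<Longrightarrow> s' x > 0"
    "\<And>x. x \<le> a \<Longrightarrow> s x = 0" "\<And>x. x \<ge> b \<Longrightarrow> s x = 1"
proof -
  define A where "A = flat 1 \<circ> (\<lambda>x. x + (- a))"
  define B where "B = flat 1 \<circ> (\<lambda>x. b + (-1) * x)"
  \<comment> \<open>\<open>B'\<close> is minus the derivative of \<open>B\<close>, so that all four
    functions are nonnegative and the numerator of the derivative is a sum.\<close>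
  define A' B' where "A' = (\<lambda>x. flat [:0, 0, 1:] (x - a))" and "B' = (\<lambda>x. flat [:0, 0, 1:] (b - x))"
  have CA: "Ck_on k UNIV A" and CB: "Ck_on k UNIV B" for k
    unfolding A_def B_def
    by (intro Ck_on_compose[where T=UNIV] Ck_on_flat Ck_on_add Ck_on_mult Ck_on_const Ck_on_id; simp)+
  have f: "(flat 1 has_real_derivative flat [:0, 0, 1:] x) (at x)" for x
    using flat_has_derivative[of 1 x] by simp
  have dA: "(A has_real_derivative A' x) (at x)" for x
  proof -
    have "((\<lambda>x. x - a) has_real_derivative 1) (at x)"
      by (auto intro!: derivative_eq_intros)
    from DERIV_chain2[OF f this] show ?thesis
      by (simp add: A_def A'_def comp_def)
  qed
  have dB: "(B has_real_derivative - B' x) (at x)" for x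
  proof -
    have "((\<lambda>x. b - x) has_real_derivative -1) (at x)"
      by (auto intro!: derivative_eq_intros)
    from DERIV_chain2[OF f this] show ?thesis
      by (simp add: B_def B'_def comp_def)
  qed
  have A0: "A x \<ge> 0" "A' x \<ge> 0" "B x \<ge> 0" "B' x \<ge> 0" for x
    by (auto simp: A_def A'_def B_def B'_def flat_def)
  have A1: "A x > 0" "A' x > 0" if "x > a" for x
    using that by (auto simp: A_def A'_def flat_def)
  have B1: "B x > 0" "B' x > 0" if "x < b" for x
    using that by (auto simp: B_def B'_def flat_def)
  have Az: "A x = 0" if "x \<le> a" for x
    using that by (auto simp: A_def flat_def)
  have Bz: "B x = 0" if "x \<ge> b" for x
    using that by (auto simp: B_def flat_def)
  have AB: "A x + B x > 0" for x
    using A0[of x] A1[of x] B1[of x] assms by (cases "x > a") auto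
  show thesis
  proof (rule that[of "\<lambda>x. A x * inverse (A x + B x)" "\<lambda>x. (A' x * B x + A x * B' x) / (A x + B x)\<^sup>2"])
    show "Ck_on k UNIV (\<lambda>x. A x * inverse (A x + B x))" for k
      by (intro Ck_on_mult Ck_on_inverse Ck_on_add CA CB) (simp_all add: AB less_imp_neq[THEN not_sym])
    show "((\<lambda>x. A x * inverse (A x + B x)) has_real_derivative (A' x * B x + A x * B' x) / (A x + B x)\<^sup>2) (at x)" for x
      using AB[of x]
      by (auto intro!: derivative_eq_intros dA dB simp: divide_simps) (simp add: algebra_simps power2_eq_square)
    show "(A' x * B x + A x * B' x) / (A x + B x)\<^sup>2 \<ge> 0" for x
      using A0 by simp
    show "(A' x * B x + A x * B' x) / (A x + B x)\<^sup>2 > 0" if "x \<in> {a<..<b}" for x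
      using A1[of x] B1[of x] that by (auto intro!: divide_pos_pos add_pos_pos mult_pos_pos)
    show "A x * inverse (A x + B x) = 0" if "x \<le> a" for x
      using Az[OF that] by simp
    show "A x * inverse (A x + B x) = 1" if "x \<ge> b" for x
      using Bz[OF that] AB[of x] by simp
  qed
qed

section \<open>Atlases on the real line\<close>

text \<open>Interval domains allow the intermediate value theorem inside a chart. Increasing charts
  have transition maps with positive derivative, so the sign of a derivative does not depend on the
  chart.\<close>

locale line_atlas =
  fixes k :: enat and C :: "(real set \<times> (real \<Rightarrow> real)) set"
  assumes k: "k \<ge> 1"
    and interval: "\<And>J \<theta>. (J, \<theta>) \<in> C \<Longrightarrow> \<exists>p q. J = {p<..<q}"
    and cont: "\<And>J \<theta>. (J, \<theta>) \<in> C \<Longrightarrow> continuous_on J \<theta>"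
    and smono: "\<And>J \<theta>. (J, \<theta>) \<in> C \<Longrightarrow> strict_mono_on J \<theta>"
    and trans: "\<And>I \<psi> J \<theta>. (I, \<psi>) \<in> C \<Longrightarrow> (J, \<theta>) \<in> C \<Longrightarrow> Ck_on k (\<psi> ` (I \<inter> J)) (\<theta> \<circ> inv_into I \<psi>)"
    and cover: "\<And>x. \<exists>J \<theta>. (J, \<theta>) \<in> C \<and> x \<in> J"
begin

text \<open>Unlike charts, these functions form a convex cone. \<open>W\<close> records where the
  derivative is already known to be positive; under addition these sets unite, and once
  \<open>W\<close> is the whole line the function lacks only surjectivity to be a global
  chart.\<close>

definition Ck_mono :: "(real \<Rightarrow> real) \<Rightarrow> real set \<Rightarrow> bool" where
  "Ck_mono F W \<longleftrightarrow> (\<forall>(J, \<theta>)\<in>C. Ck_on k (\<theta> ` J) (F \<circ> inv_into J \<theta>) \<and>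
     (\<forall>x\<in>J. deriv (F \<circ> inv_into J \<theta>) (\<theta> x) \<ge> 0 \<and> (x \<in> W \<longrightarrow> deriv (F \<circ> inv_into J \<theta>) (\<theta> x) > 0)))"

lemma Ck_mono_Ck_on: "Ck_mono F W \<Longrightarrow> (J, \<theta>) \<in> C \<Longrightarrow> Ck_on k (\<theta> ` J) (F \<circ> inv_into J \<theta>)"
  unfolding Ck_mono_def by blast

lemma Ck_mono_deriv_nonneg:
  "Ck_mono F W \<Longrightarrow> (J, \<theta>) \<in> C \<Longrightarrow> x \<in> J \<Longrightarrow> deriv (F \<circ> inv_into J \<theta>) (\<theta> x) \<ge> 0"
  unfolding Ck_mono_def by blast

lemma Ck_mono_deriv_pos:
  "Ck_mono F W \<Longrightarrow> (J, \<theta>) \<in> C \<Longrightarrow> x \<in> J \<Longrightarrow> x \<in> W \<Longrightarrow> deriv (F \<circ> inv_into J \<theta>) (\<theta> x) > 0"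
  unfolding Ck_mono_def by blast

lemma chart_inj: "(J, \<theta>) \<in> C \<Longrightarrow> inj_on \<theta> J"
  using smono strict_mono_on_imp_inj_on by blast

lemma chart_open: "(J, \<theta>) \<in> C \<Longrightarrow> open J"
  by (drule interval) auto

lemma chart_open_image:
  assumes "(J, \<theta>) \<in> C" "open V" shows "open (\<theta> ` (J \<inter> V))"
  using assms cont[of J \<theta>] chart_inj[of J \<theta>] chart_open[of J \<theta>]
  by (intro invariance_of_domain) (auto intro: continuous_on_subset inj_on_subset)

lemma Ck_mono_has_derivative:
  assumes "Ck_mono F W" "(J, \<theta>) \<in> C" "x \<in> J"
  shows "(F \<circ> inv_into J \<theta> has_real_derivative deriv (F \<circ> inv_into J \<theta>) (\<theta> x)) (at (\<theta> x))"
  using assms chart_open_image[OF assms(2), of UNIV] k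
  by (intro Ck_on_imp_has_derivative[of "\<theta> ` J" k] Ck_mono_Ck_on) auto

lemma Ck_mono_const: "Ck_mono (\<lambda>x. c) {}"
  by (auto simp: Ck_mono_def comp_def intro: Ck_on_const)

lemma Ck_mono_subset: "Ck_mono F W \<Longrightarrow> V \<subseteq> W \<Longrightarrow> Ck_mono F V"
  unfolding Ck_mono_def by fast

lemma Ck_mono_add:
  assumes "Ck_mono F V" "Ck_mono G W"
  shows "Ck_mono (\<lambda>x. F x + G x) (V \<union> W)"
  unfolding Ck_mono_def
proof clarify
  fix J \<theta> assume J: "(J, \<theta>) \<in> C"
  have eq: "(\<lambda>x. F x + G x) \<circ> inv_into J \<theta> = (\<lambda>x. (F \<circ> inv_into J \<theta>) x + (G \<circ> inv_into J \<theta>) x)"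
    by auto
  have d: "deriv ((\<lambda>x. F x + G x) \<circ> inv_into J \<theta>) (\<theta> x) =
     deriv (F \<circ> inv_into J \<theta>) (\<theta> x) + deriv (G \<circ> inv_into J \<theta>) (\<theta> x)" if "x \<in> J" for x
    unfolding eq
    by (intro DERIV_imp_deriv DERIV_add Ck_mono_has_derivative[OF assms(1) J that] Ck_mono_has_derivative[OF assms(2) J that])
  have "Ck_on k (\<theta> ` J) ((\<lambda>x. F x + G x) \<circ> inv_into J \<theta>)"
    unfolding eq using assms J chart_open_image[OF J, of UNIV]
    by (intro Ck_on_add Ck_mono_Ck_on) auto
  moreover have "0 \<le> deriv (F \<circ> inv_into J \<theta>) (\<theta> x)" "0 \<le> deriv (G \<circ> inv_into J \<theta>) (\<theta> x)"
    "x \<in> V \<longrightarrow> 0 < deriv (F \<circ> inv_into J \<theta>) (\<theta> x)" "x \<in> W \<longrightarrow> 0 < deriv (G \<circ> inv_into J \<theta>) (\<theta> x)"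
    if "x \<in> J" for x
    using assms J that by (auto intro: Ck_mono_deriv_nonneg Ck_mono_deriv_pos)
  ultimately show "Ck_on k (\<theta> ` J) ((\<lambda>x. F x + G x) \<circ> inv_into J \<theta>) \<and>
    (\<forall>x\<in>J. 0 \<le> deriv ((\<lambda>x. F x + G x) \<circ> inv_into J \<theta>) (\<theta> x) \<and>
      (x \<in> V \<union> W \<longrightarrow> 0 < deriv ((\<lambda>x. F x + G x) \<circ> inv_into J \<theta>) (\<theta> x)))"
    by (auto simp: d intro: add_nonneg_pos add_pos_nonneg)
qed

lemma Ck_mono_scale:
  assumes "Ck_mono F V" "r > 0"
  shows "Ck_mono (\<lambda>x. r * F x) V"
  unfolding Ck_mono_def
proof clarify
  fix J \<theta> assume J: "(J, \<theta>) \<in> C"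
  have eq: "(\<lambda>x. r * F x) \<circ> inv_into J \<theta> = (\<lambda>x. r * (F \<circ> inv_into J \<theta>) x)"
    by auto
  have d: "deriv ((\<lambda>x. r * F x) \<circ> inv_into J \<theta>) (\<theta> x) = r * deriv (F \<circ> inv_into J \<theta>) (\<theta> x)" if "x \<in> J" for x
    unfolding eq by (intro DERIV_imp_deriv DERIV_cmult Ck_mono_has_derivative[OF assms(1) J that])
  have "Ck_on k (\<theta> ` J) ((\<lambda>x. r * F x) \<circ> inv_into J \<theta>)"
    unfolding eq using assms J chart_open_image[OF J, of UNIV]
    by (intro Ck_on_mult Ck_on_const Ck_mono_Ck_on) auto
  then show "Ck_on k (\<theta> ` J) ((\<lambda>x. r * F x) \<circ> inv_into J \<theta>) \<and>
    (\<forall>x\<in>J. 0 \<le> deriv ((\<lambda>x. r * F x) \<circ> inv_into J \<theta>) (\<theta> x) \<and>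
      (x \<in> V \<longrightarrow> 0 < deriv ((\<lambda>x. r * F x) \<circ> inv_into J \<theta>) (\<theta> x)))"
    using assms J
    by (auto simp: d intro!: mult_nonneg_nonneg mult_pos_pos intro: Ck_mono_deriv_nonneg Ck_mono_deriv_pos)
qed

lemma Ck_mono_sum:
  assumes "finite I" "\<And>i. i \<in> I \<Longrightarrow> Ck_mono (F i) (W i)"
  shows "Ck_mono (\<lambda>x. \<Sum>i\<in>I. F i x) (\<Union>i\<in>I. W i)"
  using assms
proof (induction I rule: finite_induct)
  case empty
  show ?case using Ck_mono_const[of 0] by simp
next
  case (insert i I)
  then have "Ck_mono (\<lambda>x. F i x + (\<Sum>i\<in>I. F i x)) (W i \<union> (\<Union>i\<in>I. W i))"
    by (intro Ck_mono_add) simp_all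
  with insert(1,2) show ?case by simp
qed

lemma Ck_mono_localI:
  assumes "\<And>J \<theta> x. (J, \<theta>) \<in> C \<Longrightarrow> x \<in> J \<Longrightarrow>
    \<exists>T. open T \<and> \<theta> x \<in> T \<and> Ck_on k T (F \<circ> inv_into J \<theta>) \<and>
     0 \<le> deriv (F \<circ> inv_into J \<theta>) (\<theta> x) \<and> (x \<in> W \<longrightarrow> 0 < deriv (F \<circ> inv_into J \<theta>) (\<theta> x))"
  shows "Ck_mono F W"
  unfolding Ck_mono_def
proof (clarify, intro conjI ballI)
  fix J \<theta> assume J: "(J, \<theta>) \<in> C"
  show "Ck_on k (\<theta> ` J) (F \<circ> inv_into J \<theta>)"
  proof (rule Ck_on_local)
    show "open (\<theta> ` J)"
      using chart_open_image[OF J, of UNIV] by simp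
    show "\<exists>T. open T \<and> y \<in> T \<and> Ck_on k T (F \<circ> inv_into J \<theta>)" if "y \<in> \<theta> ` J" for y
      using that assms[OF J] by blast
  qed
qed (use assms in blast)+

text \<open>\<open>G\<close> and \<open>W'\<close> may change with the point. That suits a locally
  finite sum, which near each point equals a finite partial sum.\<close>

lemma Ck_mono_local:
  assumes "\<And>x. \<exists>G V W'. open V \<and> x \<in> V \<and> (\<forall>y\<in>V. F y = G y) \<and> Ck_mono G W' \<and> (x \<in> W \<longrightarrow> x \<in> W')"
  shows "Ck_mono F W"
proof (rule Ck_mono_localI)
  fix J \<theta> x assume J: "(J, \<theta>) \<in> C" and that: "x \<in> J"
  show "\<exists>T. open T \<and> \<theta> x \<in> T \<and> Ck_on k T (F \<circ> inv_into J \<theta>) \<and>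
     0 \<le> deriv (F \<circ> inv_into J \<theta>) (\<theta> x) \<and> (x \<in> W \<longrightarrow> 0 < deriv (F \<circ> inv_into J \<theta>) (\<theta> x))"
  proof -
    from assms[of x] obtain G V W' where G: "open V" "x \<in> V" "\<forall>y\<in>V. F y = G y" "Ck_mono G W'" "x \<in> W \<longrightarrow> x \<in> W'"
      by blast
    let ?T = "\<theta> ` (J \<inter> V)"
    have T: "open ?T" "\<theta> x \<in> ?T"
      using chart_open_image[OF J] G that by auto
    have eq: "(F \<circ> inv_into J \<theta>) y = (G \<circ> inv_into J \<theta>) y" if "y \<in> ?T" for y
      using that G(3) chart_inj[OF J] by auto
    have "Ck_on k ?T (G \<circ> inv_into J \<theta>)"
      by (rule Ck_on_subset[OF Ck_mono_Ck_on[OF G(4) J]]) auto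
    then have "Ck_on k ?T (F \<circ> inv_into J \<theta>)"
      by (rule Ck_on_eq) (simp only: eq)
    moreover have "\<forall>\<^sub>F y in nhds (\<theta> x). (F \<circ> inv_into J \<theta>) y = (G \<circ> inv_into J \<theta>) y"
      unfolding eventually_nhds using T eq by (intro exI[of _ ?T]) blast
    then have "deriv (F \<circ> inv_into J \<theta>) (\<theta> x) = deriv (G \<circ> inv_into J \<theta>) (\<theta> x)"
      by (rule deriv_cong_ev) simp
    ultimately show ?thesis
      using G(5) that T Ck_mono_deriv_nonneg[OF G(4) J that] Ck_mono_deriv_pos[OF G(4) J that]
      by (intro exI[of _ ?T]) auto
  qed
qed

text \<open>The derivative is controlled at points \<open>\<theta> x\<close> only, while
  monotonicity needs it on the whole segment from \<open>\<theta> a\<close> to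
  \<open>\<theta> b\<close>; the intermediate value theorem shows that all its points have this
  form.\<close>

lemma chart_image_between:
  assumes J: "(J, \<theta>) \<in> C" "a \<in> J" "b \<in> J" and y: "\<theta> a \<le> y" "y \<le> \<theta> b"
  shows "\<exists>x\<in>J. a \<le> x \<and> x \<le> b \<and> y = \<theta> x"
proof -
  obtain p q where pq: "J = {p<..<q}" using interval J by blast
  have ab: "a \<le> b"
    using smono[OF J(1)] J y by (meson linorder_not_le order.trans strict_mono_onD)
  then have "continuous_on {a..b} \<theta>"
    using cont[OF J(1)] J pq by (auto elim!: continuous_on_subset)
  from IVT'[OF y ab this] show ?thesis
    using J pq by auto
qed

lemma Ck_mono_chart_le:
  assumes F: "Ck_mono F W" and J: "(J, \<theta>) \<in> C" "a \<in> J" "b \<in> J" "a \<le> b"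
  shows "F a \<le> F b"
proof -
  have "\<theta> a \<le> \<theta> b"
    using smono[OF J(1)] J by (metis order.order_iff_strict strict_mono_onD)
  moreover have "\<exists>d. (F \<circ> inv_into J \<theta> has_real_derivative d) (at y) \<and> d \<ge> 0" if y: "\<theta> a \<le> y" "y \<le> \<theta> b" for y
  proof -
    obtain x where "x \<in> J" "y = \<theta> x"
      using chart_image_between[OF J(1-3) y] by blast
    with Ck_mono_has_derivative[OF F J(1)] Ck_mono_deriv_nonneg[OF F J(1)] show ?thesis
      by blast
  qed
  ultimately have "(F \<circ> inv_into J \<theta>) (\<theta> a) \<le> (F \<circ> inv_into J \<theta>) (\<theta> b)"
    by (rule DERIV_nonneg_imp_nondecreasing)
  with J chart_inj[OF J(1)] show ?thesis by simp
qed

lemma Ck_mono_chart_less: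
  assumes F: "Ck_mono F UNIV" and J: "(J, \<theta>) \<in> C" "a \<in> J" "b \<in> J" "a < b"
  shows "F a < F b"
proof -
  have "\<theta> a < \<theta> b"
    using smono[OF J(1)] J by (metis strict_mono_onD)
  moreover have "\<exists>d. (F \<circ> inv_into J \<theta> has_real_derivative d) (at y) \<and> d > 0" if y: "\<theta> a \<le> y" "y \<le> \<theta> b" for y
  proof -
    obtain x where "x \<in> J" "y = \<theta> x"
      using chart_image_between[OF J(1-3) y] by blast
    with Ck_mono_has_derivative[OF F J(1)] Ck_mono_deriv_pos[OF F J(1)] show ?thesis
      by blast
  qed
  ultimately have "(F \<circ> inv_into J \<theta>) (\<theta> a) < (F \<circ> inv_into J \<theta>) (\<theta> b)"
    by (rule DERIV_pos_imp_increasing)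
  with J chart_inj[OF J(1)] show ?thesis by simp
qed

text \<open>The covering property in the shape that the local case of the induction rule
  \<open>Bolzano\<close> asks for.\<close>

lemma chart_ball:
  obtains J \<theta> d where "(J, \<theta>) \<in> C" "d > 0" "\<And>a b. a \<le> x \<Longrightarrow> x \<le> b \<Longrightarrow> b - a < d \<Longrightarrow> a \<in> J \<and> b \<in> J"
proof -
  obtain J \<theta> where J: "(J, \<theta>) \<in> C" "x \<in> J" using cover by blast
  then obtain p q where pq: "J = {p<..<q}" using interval by blast
  show thesis
    by (rule that[OF J(1), of "min (x - p) (q - x)"]) (use J pq in auto)
qed

text \<open>The relation F a \<le> F b is transitive and holds on short intervals inside one chart;
  \<open>Bolzano\<close> supplies the compactness argument for long ones.\<close>

lemma Ck_mono_imp_mono: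
  assumes "Ck_mono F W" "a \<le> b"
  shows "F a \<le> F b"
  using assms(2)
proof (induction a b rule: Bolzano)
  case (local x)
  obtain J \<theta> d where "(J, \<theta>) \<in> C" "d > 0" "\<And>a b. a \<le> x \<Longrightarrow> x \<le> b \<Longrightarrow> b - a < d \<Longrightarrow> a \<in> J \<and> b \<in> J"
    using chart_ball[of x] by metis
  then show ?case
    using Ck_mono_chart_le[OF assms(1)] by (intro exI[of _ d]) auto
qed auto

lemma Ck_mono_imp_strict_mono:
  assumes "Ck_mono F UNIV"
  shows "strict_mono F"
proof (rule strict_monoI)
  fix a b :: real assume "a < b"
  then have "a \<le> b" by simp
  \<comment> \<open>The local case of \<open>Bolzano\<close> includes a = x = b, so strictness has
    to be guarded by a < b.\<close>
  then have "a < b \<longrightarrow> F a < F b"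
  proof (induction a b rule: Bolzano)
    case (local x)
    obtain J \<theta> d where "(J, \<theta>) \<in> C" "d > 0" "\<And>a b. a \<le> x \<Longrightarrow> x \<le> b \<Longrightarrow> b - a < d \<Longrightarrow> a \<in> J \<and> b \<in> J"
      using chart_ball[of x] by metis
    then show ?case
      using Ck_mono_chart_less[OF assms(1)] by (intro exI[of _ d]) auto
  next
    case (trans a b c)
    then show ?case by (metis order.strict_trans order.order_iff_strict)
  qed
  with \<open>a < b\<close> show "F a < F b" by simp
qed

lemma Ck_mono_imp_continuous:
  assumes "Ck_mono F W"
  shows "continuous_on UNIV F"
proof -
  have "isCont F x" for x
  proof -
    obtain J \<theta> where J: "(J, \<theta>) \<in> C" "x \<in> J" using cover by blast
    have "continuous_on J ((F \<circ> inv_into J \<theta>) \<circ> \<theta>)"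
      using assms J by (intro continuous_on_compose cont[OF J(1)] Ck_on_imp_continuous[of k] Ck_mono_Ck_on)
    then have "continuous_on J F"
      by (rule continuous_on_eq) (use chart_inj[OF J(1)] in auto)
    then show ?thesis
      using J chart_open continuous_on_eq_continuous_at by blast
  qed
  then show ?thesis by (simp add: continuous_at_imp_continuous_on)
qed

section \<open>Step functions along the line\<close>

lemma local_step:
  assumes "\<epsilon> > 0"
  obtains p q F where "p < x0" "x0 < q" "x0 - \<epsilon> < p" "q < x0 + \<epsilon>"
    "\<And>y. y \<le> p \<Longrightarrow> F y = 0" "\<And>y. y \<ge> q \<Longrightarrow> F y = (1::real)" "Ck_mono F {p<..<q}"
proof -
  obtain I \<psi> where I: "(I, \<psi>) \<in> C" "x0 \<in> I" using cover by blast
  then obtain u v where uv: "I = {u<..<v}" using interval by blast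
  \<comment> \<open>Going at most halfway from \<open>x0\<close> to the ends of the chart keeps the
    closed interval from \<open>p\<close> to \<open>q\<close> inside \<open>I\<close>; going at most
    \<epsilon>/2 keeps it within distance \<epsilon>.\<close>
  define p q where "p = max ((u + x0) / 2) (x0 - \<epsilon> / 2)" and "q = min ((v + x0) / 2) (x0 + \<epsilon> / 2)"
  have pq: "p < x0" "x0 < q" "x0 - \<epsilon> < p" "q < x0 + \<epsilon>" "u < p" "q < v" "p \<in> I" "q \<in> I"
    using assms I uv by (auto simp: p_def q_def min_def max_def field_simps)
  have less: "\<psi> a < \<psi> b \<longleftrightarrow> a < b" if "a \<in> I" "b \<in> I" for a b
    using smono[OF I(1)] that strict_mono_on_less by blast
  have "\<psi> p < \<psi> q"
    using less pq by auto
  then obtain s s' where s: "\<And>k. Ck_on k UNIV s" "\<And>x. (s has_real_derivative s' x) (at x)"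
    "\<And>x. s' x \<ge> 0" "\<And>x. x \<in> {\<psi> p<..<\<psi> q} \<Longrightarrow> s' x > 0"
    "\<And>x. x \<le> \<psi> p \<Longrightarrow> s x = 0" "\<And>x. x \<ge> \<psi> q \<Longrightarrow> s x = 1"
    using smooth_step_exists by metis
  define F where "F = (\<lambda>y. if y \<le> p then 0 else if y \<ge> q then 1 else s (\<psi> y))"
  \<comment> \<open>\<open>s\<close> is already constant beyond \<open>\<psi> p\<close> and
    \<open>\<psi> q\<close>, so on all of \<open>I\<close> the three cases of \<open>F\<close> merge
    into one formula.\<close>
  have FI: "F y = s (\<psi> y)" if "y \<in> I" for y
  proof -
    consider "y \<le> p" | "y \<ge> q" "p < y" | "p < y" "y < q" by linarith
    then show ?thesis
    proof cases
      case 1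
      then have "\<psi> y \<le> \<psi> p" using less[of p y] that pq by linarith
      with 1 show ?thesis using s(5) by (simp add: F_def)
    next
      case 2
      then have "\<psi> q \<le> \<psi> y" using less[of y q] that pq by linarith
      with 2 show ?thesis using s(6) by (simp add: F_def)
    qed (simp add: F_def)
  qed
  have "Ck_mono F {p<..<q}"
  proof (rule Ck_mono_localI)
    fix J \<theta> x assume J: "(J, \<theta>) \<in> C" and xJ: "x \<in> J"
    show "\<exists>T. open T \<and> \<theta> x \<in> T \<and> Ck_on k T (F \<circ> inv_into J \<theta>) \<and>
       0 \<le> deriv (F \<circ> inv_into J \<theta>) (\<theta> x) \<and> (x \<in> {p<..<q} \<longrightarrow> 0 < deriv (F \<circ> inv_into J \<theta>) (\<theta> x))"
    proof (cases "x \<in> I")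
      case True
      define T where "T = \<theta> ` (J \<inter> I)"
      \<comment> \<open>\<open>\<tau>\<close> and \<open>\<sigma>\<close> are mutually inverse
        transition maps. The chain rule for \<sigma> \<circ> \<tau> makes the derivative of \<tau>
        nonzero, and since both charts increase it is nonnegative, hence positive.\<close>
      define \<tau> where "\<tau> = \<psi> \<circ> inv_into J \<theta>"
      define \<sigma> where "\<sigma> = \<theta> \<circ> inv_into I \<psi>"
      have T: "open T" "\<theta> x \<in> T"
        unfolding T_def using chart_open_image[OF J] chart_open[OF I(1)] True xJ by auto
      have T': "open (\<psi> ` (I \<inter> J))"
        using chart_open_image[OF I(1)] chart_open[OF J] by auto
      have \<tau>: "Ck_on k T \<tau>"
        unfolding T_def \<tau>_def by (rule trans[OF J I(1)])
      have \<sigma>: "Ck_on k (\<psi> ` (I \<inter> J)) \<sigma>"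
        unfolding \<sigma>_def by (rule trans[OF I(1) J])
      have "Ck_on k T (s \<circ> \<tau>)"
        by (rule Ck_on_compose[OF T(1), of UNIV]) (use s \<tau> in auto)
      moreover have eq: "(F \<circ> inv_into J \<theta>) y = (s \<circ> \<tau>) y" if "y \<in> T" for y
        using that FI chart_inj[OF J] by (auto simp: T_def \<tau>_def)
      ultimately have Ck: "Ck_on k T (F \<circ> inv_into J \<theta>)"
        using Ck_on_eq[of k T "s \<circ> \<tau>"] by simp
      have \<tau>x: "\<tau> (\<theta> x) = \<psi> x"
        using xJ chart_inj[OF J] by (auto simp: \<tau>_def)
      have d\<tau>: "(\<tau> has_real_derivative deriv \<tau> (\<theta> x)) (at (\<theta> x))"
        using Ck_on_imp_has_derivative[OF T(1) k \<tau> T(2)] .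
      have d\<sigma>: "(\<sigma> has_real_derivative deriv \<sigma> (\<psi> x)) (at (\<tau> (\<theta> x)))"
        unfolding \<tau>x using Ck_on_imp_has_derivative[OF T' k \<sigma>] True xJ by auto
      have "(\<sigma> \<circ> \<tau> has_real_derivative deriv \<sigma> (\<psi> x) * deriv \<tau> (\<theta> x)) (at (\<theta> x))"
        using DERIV_chain[OF d\<sigma> d\<tau>] .
      then have "((\<lambda>y. y) has_real_derivative deriv \<sigma> (\<psi> x) * deriv \<tau> (\<theta> x)) (at (\<theta> x))"
        by (rule has_field_derivative_transform_within_open[OF _ T])
           (use chart_inj[OF J] chart_inj[OF I(1)] in \<open>auto simp: T_def \<tau>_def \<sigma>_def\<close>)
      then have "deriv \<sigma> (\<psi> x) * deriv \<tau> (\<theta> x) = 1"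
        using DERIV_unique DERIV_ident by blast
      then have nz: "deriv \<tau> (\<theta> x) \<noteq> 0" by auto
      have "mono_on T \<tau>"
      proof (rule mono_onI)
        fix a b assume "a \<in> T" "b \<in> T" "a \<le> b"
        then obtain a' b' where ab: "a' \<in> J" "a' \<in> I" "b' \<in> J" "b' \<in> I" "a = \<theta> a'" "b = \<theta> b'"
          by (auto simp: T_def)
        then have "\<not> b' < a'"
          using smono[OF J] \<open>a \<le> b\<close> by (metis linorder_not_le strict_mono_onD)
        then have "\<psi> a' \<le> \<psi> b'"
          using less[of b' a'] ab by auto
        then show "\<tau> a \<le> \<tau> b"
          using ab chart_inj[OF J] by (simp add: \<tau>_def)
      qed
      then have "deriv \<tau> (\<theta> x) \<ge> 0"
        using mono_on_imp_deriv_nonneg[OF _ d\<tau>] T by (simp add: interior_open)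
      with nz have pos: "deriv \<tau> (\<theta> x) > 0" by simp
      have "(s \<circ> \<tau> has_real_derivative s' (\<psi> x) * deriv \<tau> (\<theta> x)) (at (\<theta> x))"
        using DERIV_chain[OF s(2) d\<tau>] by (simp add: \<tau>x)
      then have "(F \<circ> inv_into J \<theta> has_real_derivative s' (\<psi> x) * deriv \<tau> (\<theta> x)) (at (\<theta> x))"
        by (rule has_field_derivative_transform_within_open[OF _ T]) (simp only: eq)
      then have dF: "deriv (F \<circ> inv_into J \<theta>) (\<theta> x) = s' (\<psi> x) * deriv \<tau> (\<theta> x)"
        by (rule DERIV_imp_deriv)
      show ?thesis
        using T Ck s(3)[of "\<psi> x"] s(4)[of "\<psi> x"] pos less pq True
        by (intro exI[of _ T]) (auto simp: dF)
    next
      case False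
      \<comment> \<open>A point outside \<open>I\<close> cannot lie between \<open>p\<close> and
        \<open>q\<close>, so \<open>F\<close> is constant on an open ray containing it.\<close>
      define c where "c = (if x < p then 0 else 1::real)"
      define V where "V = (if x < p then {..<p} else {q<..})"
      have "\<not> (p \<le> x \<and> x \<le> q)"
        using False uv pq by auto
      then have V: "open V" "x \<in> V" "x \<notin> {p<..<q}"
        by (auto simp: V_def)
      have FV: "F y = c" if "y \<in> V" for y
        using that pq(1,2) by (auto simp: V_def F_def c_def split: if_splits)
      let ?T = "\<theta> ` (J \<inter> V)"
      have T: "open ?T" "\<theta> x \<in> ?T"
        using chart_open_image[OF J V(1)] V xJ by auto
      have eq: "(F \<circ> inv_into J \<theta>) y = c" if "y \<in> ?T" for y
        using that FV chart_inj[OF J] by auto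
      then have "Ck_on k ?T (F \<circ> inv_into J \<theta>)"
        using Ck_on_cong[of ?T "F \<circ> inv_into J \<theta>" "\<lambda>_. c"] Ck_on_const by blast
      moreover have "((\<lambda>_. c) has_real_derivative 0) (at (\<theta> x))"
        by simp
      then have "(F \<circ> inv_into J \<theta> has_real_derivative 0) (at (\<theta> x))"
        by (rule has_field_derivative_transform_within_open[OF _ T]) (simp only: eq)
      then have "deriv (F \<circ> inv_into J \<theta>) (\<theta> x) = 0"
        by (rule DERIV_imp_deriv)
      ultimately show ?thesis
        using T V by (intro exI[of _ ?T]) auto
    qed
  qed
  then show thesis
    using pq by (intro that[of p q F]) (auto simp: F_def)
qed

text \<open>Adding the step functions of two adjacent intervals gives one for their union, and
  \<open>local_step\<close> handles short intervals: again the pattern of \<open>Bolzano\<close>.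
  The margins of width 1 do not grow with the number of summands.\<close>

lemma interval_step:
  assumes "a \<le> b"
  shows "\<exists>F. (\<forall>y\<le>a - 1. F y = 0) \<and> (\<forall>y\<ge>b + 1. F y = (1::real)) \<and> Ck_mono F {a..b}"
proof -
  \<comment> \<open>Heights add up along with the functions, so the induction allows any positive
    plateau \<open>c\<close>; scaling to 1 comes at the end.\<close>
  from assms have "\<exists>F c. c > 0 \<and> (\<forall>y\<le>a - 1. F y = 0) \<and> (\<forall>y\<ge>b + 1. F y = (c::real)) \<and> Ck_mono F {a..b}"
  proof (induction a b rule: Bolzano)
    case (trans a b c)
    then obtain F G r s where F: "r > 0" "\<forall>y\<le>a - 1. F y = 0" "\<forall>y\<ge>b + 1. F y = (r::real)" "Ck_mono F {a..b}"
      and G: "s > 0" "\<forall>y\<le>b - 1. G y = 0" "\<forall>y\<ge>c + 1. G y = (s::real)" "Ck_mono G {b..c}"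
      by (elim exE conjE)
    have "Ck_mono (\<lambda>x. F x + G x) {a..c}"
      by (rule Ck_mono_subset[OF Ck_mono_add[OF F(4) G(4)]]) auto
    with F(1-3) G(1-3) trans(3,4) show ?case
      by (intro exI[of _ "\<lambda>x. F x + G x"] exI[of _ "r + s"]) auto
  next
    case (local x)
    show ?case
    proof (rule local_step[OF zero_less_one, of x])
      fix p q F
      assume F: "p < x" "x < q" "x - 1 < p" "q < x + 1"
        "\<And>y. y \<le> p \<Longrightarrow> F y = 0" "\<And>y. y \<ge> q \<Longrightarrow> F y = (1::real)" "Ck_mono F {p<..<q}"
      have "\<exists>F c. c > 0 \<and> (\<forall>y\<le>u - 1. F y = 0) \<and> (\<forall>y\<ge>v + 1. F y = (c::real)) \<and> Ck_mono F {u..v}"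
        if "u \<le> x" "x \<le> v" "v - u < min (x - p) (q - x)" for u v
      proof -
        have "Ck_mono F {u..v}"
          by (rule Ck_mono_subset[OF F(7)]) (use that in auto)
        with F(3-6) that show ?thesis
          by (intro exI[of _ F] exI[of _ 1]) auto
      qed
      then show ?thesis
        using F(1,2) by (intro exI[of _ "min (x - p) (q - x)"]) auto
    qed
  qed
  then obtain F c where F: "c > 0" "\<forall>y\<le>a - 1. F y = 0" "\<forall>y\<ge>b + 1. F y = (c::real)" "Ck_mono F {a..b}"
    by blast
  then show ?thesis
    using Ck_mono_scale[OF F(4), of "1 / c"] by (intro exI[of _ "\<lambda>x. 1 / c * F x"]) auto
qed

text \<open>The \<open>n\<close>-th summand increases from 0 to 1 on \<open>[n - 1, n + 2]\<close>; subtracting 1 from those with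
  \<open>n < 0\<close> makes the sum over all integers \<open>n\<close> locally finite, and it forces \<open>f\<close> to be unbounded in both directions.\<close>

theorem global_chart:
  obtains f where "Ck_mono f UNIV" "bij f"
proof -
  have "\<exists>F. \<forall>n::int. (\<forall>y\<le>of_int n - 1. F n y = 0) \<and> (\<forall>y\<ge>of_int n + 2. F n y = (1::real)) \<and>
      Ck_mono (F n) {of_int n..of_int n + 1}"
  proof (rule choice, rule allI)
    fix n :: int
    show "\<exists>F. (\<forall>y\<le>of_int n - 1. F y = 0) \<and> (\<forall>y\<ge>of_int n + 2. F y = (1::real)) \<and>
      Ck_mono F {of_int n..of_int n + 1}"
      using interval_step[of "of_int n" "of_int n + 1"] by (simp add: add.assoc)
  qed
  then obtain F where F0: "\<And>n y. y \<le> of_int n - 1 \<Longrightarrow> F n y = (0::real)" and F1: "\<And>n y. y \<ge> of_int n + 2 \<Longrightarrow> F n y = (1::real)"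
    and Fm: "\<And>n. Ck_mono (F n) {of_int n..of_int n + 1}" for n :: int
    by blast
  have nonneg: "F n y \<ge> 0" for n y
    using Ck_mono_imp_mono[OF Fm, of "of_int n - 1" y n] F0[of _ n] by (cases "y \<le> of_int n - 1") auto
  have le1: "F n y \<le> 1" for n y
    using Ck_mono_imp_mono[OF Fm, of y "of_int n + 2" n] F1[of n] by (cases "y \<ge> of_int n + 2") auto
  define c where "c n = (if n < 0 then 1 else 0::real)" for n :: int
  define f where "f y = (\<Sum>n\<in>{-(\<lceil>\<bar>y\<bar>\<rceil> + 1)..\<lceil>\<bar>y\<bar>\<rceil> + 1}. F n y + - c n)" for y
  \<comment> \<open>Enlarging the window changes nothing: far to the right the summand has not
    started, and far to the left it equals 1 and cancels against \<open>c n\<close>. A fixed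
    \<open>M\<close> thus serves all nearby points.\<close>
  have f: "f y = (\<Sum>n\<in>{-M..M}. F n y + - c n)" if "\<bar>y\<bar> \<le> of_int M - 1" for y M
    unfolding f_def
  proof (rule sum.mono_neutral_left)
    have "\<lceil>\<bar>y\<bar>\<rceil> \<le> M - 1"
      using that by linarith
    then show "{-(\<lceil>\<bar>y\<bar>\<rceil> + 1)..\<lceil>\<bar>y\<bar>\<rceil> + 1} \<subseteq> {-M..M}"
      by auto
    show "\<forall>n\<in>{-M..M} - {-(\<lceil>\<bar>y\<bar>\<rceil> + 1)..\<lceil>\<bar>y\<bar>\<rceil> + 1}. F n y + - c n = 0"
    proof
      fix n assume "n \<in> {-M..M} - {-(\<lceil>\<bar>y\<bar>\<rceil> + 1)..\<lceil>\<bar>y\<bar>\<rceil> + 1}"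
      then consider "n > \<lceil>\<bar>y\<bar>\<rceil> + 1" | "n < -(\<lceil>\<bar>y\<bar>\<rceil> + 1)"
        by force
      then show "F n y + - c n = 0"
      proof cases
        case 1
        then have "\<bar>y\<bar> \<le> of_int n - 1" by linarith
        with 1 show ?thesis using F0[of y n] by (auto simp: c_def)
      next
        case 2
        then have "\<bar>y\<bar> \<le> - of_int n - 2" by linarith
        with 2 show ?thesis using F1[of n y] by (auto simp: c_def)
      qed
    qed
  qed simp
  have "Ck_mono (\<lambda>y. F n y + - c n) {of_int n..of_int n + 1}" for n
    using Ck_mono_add[OF Fm[of n] Ck_mono_const[of "- c n"]] by (simp only: Un_empty_right)
  then have sum: "Ck_mono (\<lambda>y. \<Sum>n\<in>{-M..M}. F n y + - c n) (\<Union>n\<in>{-M..M}. {of_int n..of_int n + 1})" for M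
    by (intro Ck_mono_sum finite_atLeastAtMost_int)
  have fm: "Ck_mono f UNIV"
  proof (rule Ck_mono_local)
    fix x :: real
    define M where "M = \<lceil>\<bar>x\<bar>\<rceil> + 2"
    \<comment> \<open>The summand with this index has positive derivative at \<open>x\<close>, so
      the window must contain it; the extra 2 in \<open>M\<close> makes the same window valid within
      distance 1 of \<open>x\<close>.\<close>
    have "\<lfloor>x\<rfloor> \<in> {-M..M}"
      unfolding M_def by (auto; linarith)
    then have "x \<in> (\<Union>n\<in>{-M..M}. {of_int n..of_int n + 1})"
      by (rule UN_I[of "\<lfloor>x\<rfloor>"]) (simp; linarith)
    moreover have "f y = (\<Sum>n\<in>{-M..M}. F n y + - c n)" if "y \<in> {x - 1<..<x + 1}" for y
      by (rule f) (use that in \<open>auto simp: M_def; linarith\<close>)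
    ultimately show "\<exists>G V W'. open V \<and> x \<in> V \<and> (\<forall>y\<in>V. f y = G y) \<and> Ck_mono G W' \<and> (x \<in> UNIV \<longrightarrow> x \<in> W')"
      using sum[of M]
      by (intro exI[of _ "\<lambda>y. \<Sum>n\<in>{-M..M}. F n y + - c n"] exI[of _ "{x - 1<..<x + 1}"]
            exI[of _ "\<Union>n\<in>{-M..M}. {of_int n..of_int n + 1}"]) auto
  qed
  \<comment> \<open>At \<open>m\<close> the indices from 0 to m - 2, which are m - 1 in number, have
    completed their rise, and the negative ones cancel against \<open>c\<close>.\<close>
  have up: "f (real m) \<ge> real m - 1" if "m \<ge> 2" for m
  proof -
    have "f (real m) = (\<Sum>n\<in>{-(int m + 1)..int m + 1}. F n (real m) + - c n)"
      by (rule f) auto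
    also have "\<dots> \<ge> (\<Sum>n\<in>{-(int m + 1)..int m + 1}. if n \<in> {0..int m - 2} then 1 else 0)"
    proof (rule sum_mono)
      fix n assume "n \<in> {-(int m + 1)..int m + 1}"
      have "n < 0 \<Longrightarrow> F n (real m) = 1" "n \<le> int m - 2 \<Longrightarrow> F n (real m) = 1"
        using that by (auto intro!: F1)
      then show "(if n \<in> {0..int m - 2} then 1 else 0) \<le> F n (real m) + - c n"
        using nonneg[of n "real m"] by (auto simp: c_def)
    qed
    also have "(\<Sum>n\<in>{-(int m + 1)..int m + 1}. if n \<in> {0..int m - 2} then 1 else 0::real) = (\<Sum>n\<in>{0..int m - 2}. 1)"
      by (rule sum.mono_neutral_cong_right) (use that in auto)
    also have "\<dots> = real m - 1"
      using that by simp
    finally show ?thesis .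
  qed
  \<comment> \<open>At -m the indices from 1 - m to -1, again m - 1 in number, have not begun to
    rise and contribute -1 each.\<close>
  have down: "f (- real m) \<le> - (real m - 1)" if "m \<ge> 2" for m
  proof -
    have "f (- real m) = (\<Sum>n\<in>{-(int m + 1)..int m + 1}. F n (- real m) + - c n)"
      by (rule f) auto
    also have "\<dots> \<le> (\<Sum>n\<in>{-(int m + 1)..int m + 1}. if n \<in> {1 - int m.. -1} then -1 else 0)"
    proof (rule sum_mono)
      fix n assume "n \<in> {-(int m + 1)..int m + 1}"
      have "n \<ge> 0 \<Longrightarrow> F n (- real m) = 0" "n \<ge> 1 - int m \<Longrightarrow> F n (- real m) = 0"
        using that by (auto intro!: F0)
      then show "F n (- real m) + - c n \<le> (if n \<in> {1 - int m.. -1} then -1 else 0)"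
        using le1[of n "- real m"] by (auto simp: c_def)
    qed
    also have "(\<Sum>n\<in>{-(int m + 1)..int m + 1}. if n \<in> {1 - int m.. -1} then -1 else 0::real) = (\<Sum>n\<in>{1 - int m.. -1}. -1)"
      by (rule sum.mono_neutral_cong_right) (use that in auto)
    also have "\<dots> = - (real m - 1)"
      using that by simp
    finally show ?thesis .
  qed
  have "\<exists>x. f x = z" for z
  proof -
    define m where "m = nat \<lceil>\<bar>z\<bar>\<rceil> + 2"
    have "real m - 1 \<ge> \<bar>z\<bar>"
      by (simp add: m_def; linarith)
    moreover have "f (- real m) \<le> - (real m - 1)" "f (real m) \<ge> real m - 1"
      using up[of m] down[of m] by (simp_all only: m_def le_add2)
    ultimately have "f (- real m) \<le> z" "z \<le> f (real m)"
      by linarith+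
    moreover have "continuous_on {- real m..real m} f"
      using Ck_mono_imp_continuous[OF fm] continuous_on_subset by blast
    ultimately show ?thesis
      using IVT'[of f "- real m" z "real m"] by auto
  qed
  then have "bij f"
    using strict_mono_imp_inj_on[OF Ck_mono_imp_strict_mono[OF fm]] by (metis bijI surj_def)
  with fm show thesis by (rule that)
qed

end

section \<open>Charts of the line with two origins\<close>

text \<open>\<open>incl True\<close> and \<open>incl False\<close> parametrise the lines \<open>UL\<close> and \<open>VL\<close>; they agree off 0.\<close>

definition incl :: "bool \<Rightarrow> real \<Rightarrow> real option" where
  "incl b = (if b then Some else jL)"

definition proj :: "real option \<Rightarrow> real" where
  "proj p = (case p of None \<Rightarrow> 0 | Some x \<Rightarrow> x)"

lemma proj_incl [simp]: "proj (incl b x) = x"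
  by (auto simp: proj_def incl_def jL_def)

lemma incl_eq_iff: "incl b x = incl c y \<longleftrightarrow> x = y \<and> (b = c \<or> x \<noteq> 0)"
  by (auto simp: incl_def jL_def)

lemma inj_incl: "inj (incl b)"
  by (metis injI proj_incl)

lemma incl_exists: "\<exists>b x. p = incl b x"
proof (cases p)
  case None
  then have "p = incl False 0" by (simp add: incl_def jL_def)
  then show ?thesis by blast
next
  case (Some x)
  then have "p = incl True x" by (simp add: incl_def)
  then show ?thesis by blast
qed

lemma incl_proj: "proj p \<noteq> 0 \<Longrightarrow> incl b (proj p) = p"
  by (cases p) (auto simp: proj_def incl_def jL_def)

lemma orig_incl: "orig = incl True 0" "orig' = incl False 0"
  by (auto simp: orig_def orig'_def incl_def jL_def)

lemma UL_incl: "UL = range (incl True)"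
  by (simp add: UL_def incl_def)

lemma VL_incl: "VL = range (incl False)"
proof -
  have "p \<in> range jL" if "p \<noteq> Some 0" for p
    using that by (cases p) (auto simp: jL_def image_iff)
  then show ?thesis by (auto simp: VL_def incl_def jL_def)
qed

lemma openL_iff: "openL S \<longleftrightarrow> (\<forall>b. open (incl b -` S))"
  unfolding openL_def incl_def by (metis (full_types))

section \<open>Topology of the line with two origins\<close>

lemma istopology_openL: "istopology openL"
  unfolding istopology_def openL_iff
  by (auto simp: vimage_Union)

lemma openin_TL: "openin TL S \<longleftrightarrow> openL S"
  by (simp add: TL_def topology_inverse'[OF istopology_openL])

lemma topspace_TL [simp]: "topspace TL = UNIV"
proof -
  have "openin TL UNIV"
    by (simp add: openin_TL openL_iff)
  then show ?thesis
    using openin_subset by blast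
qed

lemma openL_Int: "openL S \<Longrightarrow> openL T \<Longrightarrow> openL (S \<inter> T)"
  by (simp add: openL_iff open_Int)

lemma openL_incl_image:
  assumes "open V" shows "openL (incl b ` V)"
  unfolding openL_iff
proof
  fix c
  have "incl c -` incl b ` V = (if b = c then V else V - {0})"
    by (auto simp: incl_eq_iff image_iff)
  then show "open (incl c -` incl b ` V)"
    using assms by auto
qed

lemma openL_range_incl: "openL (range (incl b))"
  using openL_incl_image[of UNIV] by simp

lemma openL_proj_vimage: "open V \<Longrightarrow> openL (proj -` V)"
  by (simp add: openL_iff vimage_def)

lemma continuous_map_TL:
  "continuous_map TL TL f \<longleftrightarrow> (\<forall>V. openL V \<longrightarrow> openL (f -` V))"
  by (auto simp: continuous_map openin_TL vimage_def)

text \<open>With f = \<open>id\<close> this is smoothness of a transition map, otherwise of the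
  coordinate expression of a map; the common form lets one change-of-charts lemma treat
  both.\<close>

definition Ck_rep :: "enat \<Rightarrow> (real option \<Rightarrow> real option) \<Rightarrow> chart \<Rightarrow> chart \<Rightarrow> bool" where
  "Ck_rep k f c d \<longleftrightarrow>
    Ck_on k (snd c ` (fst c \<inter> f -` fst d)) (snd d \<circ> f \<circ> inv_into (fst c) (snd c))"

lemma Ck_map_iff_rep: "Ck_map k S1 S2 f \<longleftrightarrow> (\<forall>c\<in>\<Union>S1. \<forall>d\<in>\<Union>S2. Ck_rep k f c d)"
  unfolding Ck_map_def Ck_rep_def by (simp add: case_prod_beta)

lemma is_chart_inj: "is_chart (D, \<phi>) \<Longrightarrow> inj_on \<phi> D"
  unfolding is_chart_def homeomorphic_eq_everything_map by (simp add: topspace_subtopology)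

lemma is_chart_openL: "is_chart (D, \<phi>) \<Longrightarrow> openL D"
  by (simp add: is_chart_def)

lemma is_chart_open_image:
  assumes "is_chart (D, \<phi>)" "openL V"
  shows "open (\<phi> ` (D \<inter> V))"
proof -
  have "open_map (subtopology TL D) (subtopology euclideanreal (\<phi> ` D)) \<phi>" "open (\<phi> ` D)"
    using assms(1) by (auto simp: is_chart_def homeomorphic_eq_everything_map)
  moreover have "openin (subtopology TL D) (D \<inter> V)"
    using assms by (auto simp: openin_subtopology openin_TL)
  ultimately show ?thesis
    unfolding open_map_def by (metis openin_open_eq)
qed

lemma is_chart_continuous:
  assumes "is_chart (D, \<phi>)"
  shows "continuous_on (incl b -` D) (\<phi> \<circ> incl b)"
proof -
  have D: "open (incl b -` D)"
    using assms is_chart_openL openL_iff by blast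
  have "continuous_map (subtopology TL D) (subtopology euclideanreal (\<phi> ` D)) \<phi>"
    using assms by (auto simp: is_chart_def homeomorphic_eq_everything_map)
  then have *: "continuous_map (subtopology TL D) euclideanreal \<phi>"
    using continuous_map_into_fulltopology by blast
  show ?thesis
    unfolding continuous_on_open_vimage[OF D]
  proof (intro allI impI)
    fix B :: "real set" assume "open B"
    with * have "openin (subtopology TL D) {x \<in> D. \<phi> x \<in> B}"
      by (auto simp: continuous_map topspace_subtopology)
    then obtain T where "openL T" "{x \<in> D. \<phi> x \<in> B} = T \<inter> D"
      by (auto simp: openin_subtopology openin_TL)
    moreover have "(\<phi> \<circ> incl b) -` B \<inter> incl b -` D = incl b -` {x \<in> D. \<phi> x \<in> B}"
      by auto
    ultimately show "open ((\<phi> \<circ> incl b) -` B \<inter> incl b -` D)"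
      using is_chart_openL[OF assms] by (simp add: openL_iff open_Int)
  qed
qed

text \<open>The inverse of a transition map is the transition map in the other direction. Disjoint
  domains are absorbed, since every function is C^k on the empty set.\<close>

lemma compatible_iff:
  assumes c: "is_chart c" and d: "is_chart d"
  shows "compatible k c d \<longleftrightarrow> Ck_rep k id c d \<and> Ck_rep k id d c"
proof -
  obtain D \<phi> E \<psi> where cd: "c = (D, \<phi>)" "d = (E, \<psi>)" by fastforce
  have inj: "inj_on \<phi> D" "inj_on \<psi> E"
    using c d is_chart_inj by (auto simp: cd)
  let ?t = "\<psi> \<circ> inv_into D \<phi>"
  have bij: "bij_betw ?t (\<phi> ` (D \<inter> E)) (\<psi> ` (D \<inter> E))"
    using inj by (auto simp: bij_betw_def inj_on_def image_iff)
  have eq: "inv_into (\<phi> ` (D \<inter> E)) ?t y = (\<phi> \<circ> inv_into E \<psi>) y" if "y \<in> \<psi> ` (D \<inter> E)" for y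
  proof (rule inv_into_f_eq)
    show "inj_on ?t (\<phi> ` (D \<inter> E))"
      using bij by (simp add: bij_betw_def)
  qed (use that inj in auto)
  have "compatible k c d \<longleftrightarrow> D \<inter> E = {} \<or> Ck_on k (\<phi> ` (D \<inter> E)) ?t \<and> Ck_on k (\<psi> ` (D \<inter> E)) (\<phi> \<circ> inv_into E \<psi>)"
    unfolding compatible_def Ck_diffeo_def cd
    using bij Ck_on_cong[of "\<psi> ` (D \<inter> E)" "inv_into (\<phi> ` (D \<inter> E)) ?t" "\<phi> \<circ> inv_into E \<psi>", OF eq] by simp
  also have "\<dots> \<longleftrightarrow> Ck_on k (\<phi> ` (D \<inter> E)) ?t \<and> Ck_on k (\<psi> ` (D \<inter> E)) (\<phi> \<circ> inv_into E \<psi>)"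
    by (cases "D \<inter> E = {}") (simp_all add: Ck_on_def)
  also have "\<dots> \<longleftrightarrow> Ck_rep k id c d \<and> Ck_rep k id d c"
    by (simp add: Ck_rep_def cd Int_commute)
  finally show ?thesis .
qed

lemma compatible_refl: "is_chart c \<Longrightarrow> compatible k c c"
proof -
  assume c: "is_chart c"
  obtain D \<phi> where cd: "c = (D, \<phi>)" by fastforce
  have "Ck_on k (\<phi> ` D) (\<phi> \<circ> inv_into D \<phi>)"
    by (rule Ck_on_eq[OF Ck_on_id]) (auto simp: f_inv_into_f)
  then show ?thesis
    using c compatible_iff[OF c c] by (simp add: cd Ck_rep_def)
qed

lemma compatible_sym: "is_chart c \<Longrightarrow> is_chart d \<Longrightarrow> compatible k c d \<longleftrightarrow> compatible k d c"
  using compatible_iff by blast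

text \<open>Smoothness is local, and near \<open>x\<close> the expression of \<open>f\<close>
  factors through charts that may depend on \<open>x\<close>; so one good pair of charts around each
  point suffices. Continuity of \<open>f\<close> makes the domains of the factorisation
  open.\<close>

lemma Ck_rep_change_charts:
  assumes c: "is_chart c" and d: "is_chart d" and f: "continuous_map TL TL f"
    and ex: "\<And>x. x \<in> fst c \<Longrightarrow> f x \<in> fst d \<Longrightarrow> \<exists>c' d'. is_chart c' \<and> is_chart d' \<and>
      x \<in> fst c' \<and> f x \<in> fst d' \<and> Ck_rep k id c c' \<and> Ck_rep k id d' d \<and> Ck_rep k f c' d'"
  shows "Ck_rep k f c d"
proof -
  obtain D \<phi> E \<psi> where cd: "c = (D, \<phi>)" "d = (E, \<psi>)" by fastforce
  have fo: "openL V \<Longrightarrow> openL (f -` V)" for V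
    using f continuous_map_TL by blast
  have inj: "inj_on \<phi> D" "inj_on \<psi> E" and opn: "openL D" "openL E"
    using c d is_chart_inj is_chart_openL by (auto simp: cd)
  have "Ck_on k (\<phi> ` (D \<inter> f -` E)) (\<psi> \<circ> f \<circ> inv_into D \<phi>)"
  proof (rule Ck_on_local)
    show "open (\<phi> ` (D \<inter> f -` E))"
      using c fo opn by (auto simp: cd intro: is_chart_open_image)
    fix y assume "y \<in> \<phi> ` (D \<inter> f -` E)"
    then obtain x where x: "x \<in> D" "f x \<in> E" "y = \<phi> x" by auto
    obtain c' d' where "is_chart c'" "is_chart d'"
      "x \<in> fst c'" "f x \<in> fst d'" "Ck_rep k id c c'" "Ck_rep k id d' d" "Ck_rep k f c' d'"
      using ex[of x] x cd by auto
    then obtain D' \<phi>' E' \<psi>' where *: "is_chart (D', \<phi>')" "is_chart (E', \<psi>')"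
      "x \<in> D'" "f x \<in> E'" "Ck_rep k id (D, \<phi>) (D', \<phi>')" "Ck_rep k id (E', \<psi>') (E, \<psi>)"
      "Ck_rep k f (D', \<phi>') (E', \<psi>')"
      by (cases c'; cases d') (auto simp: cd)
    have inj': "inj_on \<phi>' D'" "inj_on \<psi>' E'" and opn': "openL D'" "openL E'"
      using * is_chart_inj is_chart_openL by auto
    define T where "T = \<phi> ` (D \<inter> (D' \<inter> f -` (E \<inter> E')))"
    define T1 where "T1 = \<phi>' ` (D' \<inter> f -` E')"
    define T2 where "T2 = \<psi>' ` (E' \<inter> E)"
    have T: "open T" "y \<in> T" and T1: "open T1" and T2: "open T2"
    proof -
      show "open T" unfolding T_def
        by (rule is_chart_open_image) (use c opn opn' cd in \<open>auto intro!: openL_Int fo\<close>)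
      show "open T1" unfolding T1_def
        by (rule is_chart_open_image) (use * opn opn' cd in \<open>auto intro!: openL_Int fo\<close>)
      show "open T2" unfolding T2_def
        by (rule is_chart_open_image) (use * opn opn' cd in \<open>auto intro!: openL_Int fo\<close>)
      show "y \<in> T" using x * by (auto simp: T_def)
    qed
    have A: "Ck_on k T (\<phi>' \<circ> inv_into D \<phi>)"
      by (rule Ck_on_subset[of k "\<phi> ` (D \<inter> D')"]) (use *(5) in \<open>auto simp: Ck_rep_def T_def\<close>)
    have AB: "Ck_on k T ((\<psi>' \<circ> f \<circ> inv_into D' \<phi>') \<circ> (\<phi>' \<circ> inv_into D \<phi>))"
    proof (rule Ck_on_compose[OF T(1) T1 _ A])
      show "(\<phi>' \<circ> inv_into D \<phi>) ` T \<subseteq> T1"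
        using inj by (auto simp: T_def T1_def)
      show "Ck_on k T1 (\<psi>' \<circ> f \<circ> inv_into D' \<phi>')"
        using *(7) by (simp add: Ck_rep_def T1_def)
    qed
    have "Ck_on k T ((\<psi> \<circ> inv_into E' \<psi>') \<circ> ((\<psi>' \<circ> f \<circ> inv_into D' \<phi>') \<circ> (\<phi>' \<circ> inv_into D \<phi>)))"
    proof (rule Ck_on_compose[OF T(1) T2 _ AB])
      show "((\<psi>' \<circ> f \<circ> inv_into D' \<phi>') \<circ> (\<phi>' \<circ> inv_into D \<phi>)) ` T \<subseteq> T2"
        using inj inj' by (auto simp: T_def T2_def)
      show "Ck_on k T2 (\<psi> \<circ> inv_into E' \<psi>')"
        using *(6) by (simp add: Ck_rep_def T2_def)
    qed
    then have "Ck_on k T (\<psi> \<circ> f \<circ> inv_into D \<phi>)"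
      by (rule Ck_on_eq) (use inj inj' in \<open>auto simp: T_def\<close>)
    with T show "\<exists>T. open T \<and> y \<in> T \<and> Ck_on k T (\<psi> \<circ> f \<circ> inv_into D \<phi>)"
      by (intro exI[of _ T]) simp
  qed
  then show ?thesis by (simp add: Ck_rep_def cd)
qed

text \<open>Compatibility is not transitive by itself, since a middle chart may miss part of the
  overlap. A whole atlas in the middle offers a suitable chart around every point.\<close>

lemma atlas_compatible_trans:
  assumes A: "is_atlas k A" and c: "is_chart c" "\<And>a. a \<in> A \<Longrightarrow> compatible k c a"
    and d: "is_chart d" "\<And>a. a \<in> A \<Longrightarrow> compatible k d a"
  shows "compatible k c d"
proof -
  have chart: "is_chart a" if "a \<in> A" for a
    using A that by (simp add: is_atlas_def)
  have *: "Ck_rep k id c d" if c: "is_chart c" "\<And>a. a \<in> A \<Longrightarrow> compatible k c a"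
    and d: "is_chart d" "\<And>a. a \<in> A \<Longrightarrow> compatible k d a" for c d
  proof (rule Ck_rep_change_charts[OF c(1) d(1)])
    fix x
    have "x \<in> (\<Union>c\<in>A. fst c)"
      using A by (simp add: is_atlas_def)
    then obtain a where a: "a \<in> A" "x \<in> fst a" by blast
    show "\<exists>c' d'. is_chart c' \<and> is_chart d' \<and> x \<in> fst c' \<and> id x \<in> fst d' \<and>
       Ck_rep k id c c' \<and> Ck_rep k id d' d \<and> Ck_rep k id c' d'"
      using a chart[OF a(1)] c(2)[OF a(1)] d(2)[OF a(1)] compatible_refl[of a k]
      by (intro exI[of _ a]) (simp add: compatible_iff c(1) d(1))
  qed (simp add: continuous_map_TL)
  show ?thesis
    using *[OF c d] *[OF d c] by (simp add: compatible_iff[OF c(1) d(1)])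
qed

text \<open>The two charts may come from different atlases of \<open>S\<close>; both are compatible
  with the atlas \<open>A\<close> that defines \<open>S\<close>, which then serves as the
  middle.\<close>

lemma structure_charts:
  assumes "is_structure k S" "c \<in> \<Union>S" "d \<in> \<Union>S"
  shows "is_chart c" "compatible k c d"
proof -
  obtain A where A: "is_atlas k A" "S = {B. is_atlas k B \<and> is_atlas k (A \<union> B)}"
    using assms(1) by (auto simp: is_structure_def)
  have *: "is_chart c" "\<And>a. a \<in> A \<Longrightarrow> compatible k c a" if "c \<in> \<Union>S" for c
    using that A(2) by (auto simp: is_atlas_def)
  show "is_chart c"
    using *(1)[OF assms(2)] .
  show "compatible k c d"
    by (rule atlas_compatible_trans[OF A(1) *[OF assms(2)] *[OF assms(3)]])
qed

lemma structure_of_atlas: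
  assumes "is_atlas k A"
  shows "\<exists>S. is_structure k S \<and> A \<in> S"
  using assms unfolding is_structure_def
  by (intro exI[of _ "{B. is_atlas k B \<and> is_atlas k (A \<union> B)}"]) auto

section \<open>Existence of minimal atlases\<close>

text \<open>A continuous bijection of the real line is a homeomorphism by invariance of domain, so
  these are the homeomorphisms fixing 0.\<close>

definition homeo0 :: "(real \<Rightarrow> real) \<Rightarrow> bool" where
  "homeo0 f \<longleftrightarrow> bij f \<and> continuous_on UNIV f \<and> f 0 = 0"

lemma homeo0_open_image: "homeo0 f \<Longrightarrow> open S \<Longrightarrow> open (f ` S)"
  using invariance_of_domain[of S f]
  by (auto simp: homeo0_def bij_def intro: continuous_on_subset inj_on_subset)

lemma homeo0_inv:
  assumes "homeo0 f" shows "homeo0 (inv f)"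
proof -
  have "continuous_on UNIV (inv f)"
    unfolding continuous_on_open_vimage[OF open_UNIV]
    using homeo0_open_image[OF assms] assms by (auto simp: homeo0_def bij_vimage_eq_inv_image bij_imp_bij_inv inv_inv_eq)
  moreover have "inv f 0 = 0"
    using assms by (metis homeo0_def bij_inv_eq_iff)
  ultimately show ?thesis
    using assms by (simp add: homeo0_def bij_imp_bij_inv)
qed

lemma homeo0_comp: "homeo0 f \<Longrightarrow> homeo0 g \<Longrightarrow> homeo0 (f \<circ> g)"
  unfolding homeo0_def
  by (intro conjI bij_comp continuous_on_compose) (auto elim: continuous_on_subset)

lemma homeo0_id: "homeo0 id"
  by (simp add: homeo0_def)

lemma homeo0_eq_0: "homeo0 f \<Longrightarrow> f x = 0 \<longleftrightarrow> x = 0"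
  by (metis homeo0_def bij_def injD)

text \<open>A chart is a total function of which only the values on its domain count; hence \<phi>
  is constrained through \<open>\<phi> \<circ> incl b\<close> alone.\<close>

lemma is_chart_range_inclI:
  assumes f: "bij f" "continuous_on UNIV f" and eq: "\<phi> \<circ> incl b = f"
  shows "is_chart (range (incl b), \<phi>)"
proof -
  let ?W = "range (incl b)"
  have \<phi>: "\<phi> (incl b x) = f x" for x
    using eq by (metis comp_apply)
  have im: "\<phi> ` ?W = UNIV"
    using f(1) by (simp add: image_image \<phi> bij_is_surj)
  have "homeomorphic_map (subtopology TL ?W) euclideanreal \<phi>"
  proof (rule bijective_open_imp_homeomorphic_map)
    show "continuous_map (subtopology TL ?W) euclideanreal \<phi>"
      unfolding continuous_map
    proof (intro conjI allI impI)
      fix B :: "real set" assume "openin euclideanreal B"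
      then have "open (f -` B)"
        using f(2) continuous_on_open_vimage[OF open_UNIV] by auto
      moreover have "{x \<in> topspace (subtopology TL ?W). \<phi> x \<in> B} = incl b ` (f -` B)"
        by (auto simp: \<phi>)
      ultimately show "openin (subtopology TL ?W) {x \<in> topspace (subtopology TL ?W). \<phi> x \<in> B}"
        by (auto simp: openin_subtopology openin_TL intro!: exI[of _ "incl b ` (f -` B)"] openL_incl_image)
    qed auto
    show "open_map (subtopology TL ?W) euclideanreal \<phi>"
      unfolding open_map_def
    proof (intro allI impI)
      fix U assume "openin (subtopology TL ?W) U"
      then obtain T where T: "openL T" "U = T \<inter> ?W"
        by (auto simp: openin_subtopology openin_TL)
      then have "open (f ` (incl b -` T))"
        using f by (intro invariance_of_domain)
          (auto simp: openL_iff bij_def intro: continuous_on_subset inj_on_subset)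
      moreover have "\<phi> ` U = f ` (incl b -` T)"
      proof -
        have "U = incl b ` (incl b -` T)" using T(2) by auto
        then have "\<phi> ` U = \<phi> ` (incl b ` (incl b -` T))" by (rule arg_cong)
        then show ?thesis by (simp only: image_image \<phi>)
      qed
      ultimately show "openin euclideanreal (\<phi> ` U)" by simp
    qed
    show "\<phi> ` topspace (subtopology TL ?W) = topspace euclideanreal"
      by (simp add: im)
    show "inj_on \<phi> (topspace (subtopology TL ?W))"
      using f(1) by (auto simp: inj_on_def \<phi> bij_def inj_def)
  qed
  then show ?thesis
    unfolding is_chart_def using openL_range_incl im by simp
qed

lemma is_chart_range_inclD:
  assumes "is_chart (range (incl b), \<phi>)" "\<phi> ` range (incl b) = UNIV"
  shows "bij (\<phi> \<circ> incl b)" "continuous_on UNIV (\<phi> \<circ> incl b)"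
proof -
  have "inj (\<phi> \<circ> incl b)"
    using is_chart_inj[OF assms(1)] inj_incl by (simp add: comp_inj_on)
  moreover have "surj (\<phi> \<circ> incl b)"
    using assms(2) by (simp add: image_comp)
  ultimately show "bij (\<phi> \<circ> incl b)" by (simp add: bij_def)
  have "incl b -` range (incl b) = UNIV" by auto
  then show "continuous_on UNIV (\<phi> \<circ> incl b)"
    using is_chart_continuous[OF assms(1), of b] by simp
qed

lemma inv_into_range_incl:
  assumes "bij (\<phi> \<circ> incl b)"
  shows "inv_into (range (incl b)) \<phi> y = incl b (inv (\<phi> \<circ> incl b) y)"
proof (rule inv_into_f_eq)
  show "inj_on \<phi> (range (incl b))"
    using assms by (metis bij_is_inj inj_on_imageI)
  show "\<phi> (incl b (inv (\<phi> \<circ> incl b) y)) = y"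
    using assms by (metis bij_inv_eq_iff comp_apply)
qed simp

text \<open>The sign \<open>r\<close> makes every restricted chart increasing.\<close>

definition line_charts :: "chart set \<Rightarrow> bool \<Rightarrow> (real set \<times> (real \<Rightarrow> real)) set" where
  "line_charts A b = {(J, \<theta>). (\<exists>p q. J = {p<..<q}) \<and> strict_mono_on J \<theta> \<and>
     (\<exists>D \<phi> r. (D, \<phi>) \<in> A \<and> incl b ` J \<subseteq> D \<and> r * r = 1 \<and> \<theta> = (\<lambda>x. r * \<phi> (incl b x)))}"

lemma line_charts_exist:
  assumes "is_atlas k A" "(D, \<phi>) \<in> A" "incl b x \<in> D"
  shows "\<exists>J r. (J, \<lambda>x. r * \<phi> (incl b x)) \<in> line_charts A b \<and> x \<in> J \<and> incl b ` J \<subseteq> D \<and> r * r = 1"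
proof -
  have c: "is_chart (D, \<phi>)"
    using assms by (auto simp: is_atlas_def)
  then have "open (incl b -` D)"
    using is_chart_openL openL_iff by blast
  with assms(3) obtain e where e: "e > 0" "ball x e \<subseteq> incl b -` D"
    by (metis open_contains_ball vimage_eq)
  define J where "J = {x - e<..<x + e}"
  have J: "J \<subseteq> incl b -` D" "x \<in> J"
    using e by (auto simp: J_def ball_eq_greaterThanLessThan)
  have "continuous_on J (\<phi> \<circ> incl b)"
    using is_chart_continuous[OF c] J continuous_on_subset by blast
  moreover have "inj_on (\<phi> \<circ> incl b) J"
    using inj_on_subset[OF is_chart_inj[OF c], of "incl b ` J"] J(1) inj_on_subset[OF inj_incl]
    by (intro comp_inj_on) auto
  \<comment> \<open>A continuous injection on an interval is strictly monotone; in the decreasing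
    case r = -1 reverses it. The condition r * r = 1 makes multiplication by \<open>r\<close> its
    own inverse.\<close>
  ultimately have "strict_mono_on J (\<phi> \<circ> incl b) \<or> strict_antimono_on J (\<phi> \<circ> incl b)"
    using injective_eq_monotone_map[of J "\<phi> \<circ> incl b"] by (auto simp: J_def is_interval_oo)
  then obtain r :: real where r: "r * r = 1" "strict_mono_on J (\<lambda>x. r * \<phi> (incl b x))"
  proof
    assume "strict_mono_on J (\<phi> \<circ> incl b)"
    then show thesis by (intro that[of 1]) (auto simp: comp_def)
  next
    assume "strict_antimono_on J (\<phi> \<circ> incl b)"
    then show thesis by (intro that[of "-1"]) (auto simp: monotone_on_def)
  qed
  have "\<exists>p q. J = {p<..<q}" unfolding J_def by blast
  with r J assms(2) have "(J, \<lambda>x. r * \<phi> (incl b x)) \<in> line_charts A b"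
    unfolding line_charts_def by blast
  with r J show ?thesis by blast
qed

lemma Ck_on_scale: "Ck_on k S ((*) r)"
proof -
  have "Ck_on k UNIV (\<lambda>x. r * x)"
    by (intro Ck_on_mult Ck_on_const Ck_on_id) simp
  then show ?thesis by (rule Ck_on_subset) simp
qed

lemma line_charts_line_atlas:
  assumes "k \<ge> 1" and A: "is_atlas k A"
  shows "line_atlas k (line_charts A b)"
proof
  show "1 \<le> k" by fact
  show "\<exists>p q. J = {p<..<q}" if "(J, \<theta>) \<in> line_charts A b" for J \<theta>
    using that by (simp add: line_charts_def)
  show cont: "continuous_on J \<theta>" if "(J, \<theta>) \<in> line_charts A b" for J \<theta>
  proof -
    from that obtain D \<phi> r where *: "(D, \<phi>) \<in> A" "incl b ` J \<subseteq> D" "\<theta> = (\<lambda>x. r * \<phi> (incl b x))"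
      by (auto simp: line_charts_def)
    then have "continuous_on (incl b -` D) (\<phi> \<circ> incl b)"
      using A by (intro is_chart_continuous) (auto simp: is_atlas_def)
    then have "continuous_on J (\<phi> \<circ> incl b)"
      by (rule continuous_on_subset) (use *(2) in auto)
    then show ?thesis
      unfolding *(3) by (intro continuous_on_mult continuous_on_const) (simp add: comp_def)
  qed
  show sm: "strict_mono_on J \<theta>" if "(J, \<theta>) \<in> line_charts A b" for J \<theta>
    using that by (simp add: line_charts_def)
  show "Ck_on k (\<psi> ` (I \<inter> J)) (\<theta> \<circ> inv_into I \<psi>)"
    if I: "(I, \<psi>) \<in> line_charts A b" and J: "(J, \<theta>) \<in> line_charts A b" for I \<psi> J \<theta>
  proof -
    from I obtain D \<phi> r where *: "(D, \<phi>) \<in> A" "incl b ` I \<subseteq> D" "r * r = 1" "\<psi> = (\<lambda>x. r * \<phi> (incl b x))"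
      by (auto simp: line_charts_def)
    from J obtain E \<omega> t where **: "(E, \<omega>) \<in> A" "incl b ` J \<subseteq> E" "t * t = 1" "\<theta> = (\<lambda>x. t * \<omega> (incl b x))"
      by (auto simp: line_charts_def)
    have chart: "is_chart (D, \<phi>)" "is_chart (E, \<omega>)"
      using A * ** by (auto simp: is_atlas_def)
    have "open I" "open J"
      using I J by (auto simp: line_charts_def)
    have inj: "inj_on \<psi> I"
      using sm[OF I] by (rule strict_mono_on_imp_inj_on)
    have T: "open (\<psi> ` (I \<inter> J))"
      using cont[OF I] inj \<open>open I\<close> \<open>open J\<close>
      by (intro invariance_of_domain) (auto intro: continuous_on_subset inj_on_subset)
    have T1: "open (\<phi> ` (D \<inter> E))"
      using is_chart_open_image[OF chart(1)] is_chart_openL[OF chart(2)] by blast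
    have "compatible k (D, \<phi>) (E, \<omega>)"
      using A * ** by (auto simp: is_atlas_def)
    then have tr: "Ck_on k (\<phi> ` (D \<inter> E)) (\<omega> \<circ> inv_into D \<phi>)"
      using compatible_iff[OF chart] by (simp add: Ck_rep_def)
    have rr: "r * (r * y) = y" for y
      using *(3) by (simp add: mult.assoc[symmetric])
    \<comment> \<open>Undo the sign \<open>r\<close>, apply the transition map of the atlas, then
      apply the sign \<open>t\<close>.\<close>
    have "Ck_on k (\<psi> ` (I \<inter> J)) ((*) t \<circ> ((\<omega> \<circ> inv_into D \<phi>) \<circ> (*) r))"
    proof (rule Ck_on_compose[OF T open_UNIV _ Ck_on_compose[OF T T1 _ Ck_on_scale tr] Ck_on_scale])
      show "(*) r ` \<psi> ` (I \<inter> J) \<subseteq> \<phi> ` (D \<inter> E)"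
        using *(2) **(2) by (auto simp: *(4) rr intro!: imageI)
    qed simp
    then show ?thesis
    proof (rule Ck_on_eq)
      fix y assume "y \<in> \<psi> ` (I \<inter> J)"
      then obtain x where x: "x \<in> I" "x \<in> J" "y = \<psi> x" by blast
      then have "inv_into I \<psi> y = x" using inj by simp
      moreover have "inv_into D \<phi> (r * y) = incl b x"
        using x *(2) is_chart_inj[OF chart(1)] by (auto simp: *(4) rr)
      ultimately show "((*) t \<circ> ((\<omega> \<circ> inv_into D \<phi>) \<circ> (*) r)) y = (\<theta> \<circ> inv_into I \<psi>) y"
        by (simp add: **(4))
    qed
  qed
  show "\<exists>J \<theta>. (J, \<theta>) \<in> line_charts A b \<and> x \<in> J" for x
  proof -
    have "incl b x \<in> (\<Union>c\<in>A. fst c)"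
      using A by (simp add: is_atlas_def)
    then obtain D \<phi> where "(D, \<phi>) \<in> A" "incl b x \<in> D" by force
    from line_charts_exist[OF A this] show ?thesis by blast
  qed
qed

text \<open>Compatibility needs both directions. Smoothness of \<open>G\<close> is checked locally
  in oriented charts; that of its inverse comes from \<open>Ck_on_inv_into\<close>, for which the
  global chart was built with nonvanishing derivative.\<close>

lemma atlas_line_chart:
  assumes k: "k \<ge> 1" and A: "is_atlas k A"
  obtains f where "homeo0 f" "\<And>a. a \<in> A \<Longrightarrow> compatible k (range (incl b), f \<circ> proj) a"
proof -
  interpret line_atlas k "line_charts A b"
    by (rule line_charts_line_atlas[OF k A])
  obtain g where g: "Ck_mono g UNIV" "bij g"
    by (rule global_chart)
  define f where "f x = g x + - g 0" for x
  have cont: "continuous_on UNIV f"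
    unfolding f_def by (intro continuous_on_add continuous_on_const Ck_mono_imp_continuous[OF g(1)])
  have "f = (\<lambda>y. y + - g 0) \<circ> g" by (auto simp: f_def)
  moreover have "bij (\<lambda>y. y + - g 0)"
    by (rule bij_plus_right)
  ultimately have bij: "bij f"
    using g(2) bij_comp by blast
  have Ck: "Ck_on k (\<theta> ` J) (f \<circ> inv_into J \<theta>)" if "(J, \<theta>) \<in> line_charts A b" for J \<theta>
  proof -
    have "Ck_on k (\<theta> ` J) (\<lambda>x. (g \<circ> inv_into J \<theta>) x + - g 0)"
      using chart_open_image[OF that, of UNIV] by (intro Ck_on_add Ck_on_const Ck_mono_Ck_on[OF g(1) that]) simp
    then show ?thesis by (rule Ck_on_eq) (simp add: f_def)
  qed
  have der: "\<exists>d. (f \<circ> inv_into J \<theta> has_real_derivative d) (at (\<theta> x)) \<and> d \<noteq> 0"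
    if "(J, \<theta>) \<in> line_charts A b" "x \<in> J" for J \<theta> x
  proof -
    have "(f \<circ> inv_into J \<theta>) = (\<lambda>x. (g \<circ> inv_into J \<theta>) x + - g 0)"
      by (auto simp: f_def)
    then have "(f \<circ> inv_into J \<theta> has_real_derivative deriv (g \<circ> inv_into J \<theta>) (\<theta> x)) (at (\<theta> x))"
      using DERIV_add[OF Ck_mono_has_derivative[OF g(1) that] DERIV_const[of "- g 0"]] by simp
    with Ck_mono_deriv_pos[OF g(1) that] show ?thesis
      by (metis UNIV_I less_numeral_extra(3))
  qed
  let ?W = "range (incl b)"
  let ?c = "(?W, f \<circ> proj)"
  have fp: "(f \<circ> proj) \<circ> incl b = f" by auto
  have chart: "is_chart ?c"
    by (rule is_chart_range_inclI[OF bij cont fp])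
  have "compatible k ?c a" if "a \<in> A" for a
  proof -
    obtain D \<omega> where a: "a = (D, \<omega>)" by fastforce
    have ca: "is_chart (D, \<omega>)"
      using A that by (auto simp: is_atlas_def a)
    have inj: "inj_on \<omega> D" using is_chart_inj[OF ca] .
    define G where "G = (f \<circ> proj) \<circ> inv_into D \<omega>"
    define S where "S = \<omega> ` (D \<inter> ?W)"
    have S: "open S"
      unfolding S_def by (rule is_chart_open_image[OF ca openL_range_incl])
    have loc: "\<exists>T d. open T \<and> y \<in> T \<and> Ck_on k T G \<and> (G has_real_derivative d) (at y) \<and> d \<noteq> 0" if "y \<in> S" for y
    proof -
      from that obtain x where x: "incl b x \<in> D" "y = \<omega> (incl b x)"
        by (auto simp: S_def)
      obtain J r where J: "(J, \<lambda>x. r * \<omega> (incl b x)) \<in> line_charts A b" "x \<in> J" "incl b ` J \<subseteq> D" "r * r = 1"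
        using line_charts_exist[OF A _ x(1)] \<open>a \<in> A\<close> a by blast
      define \<theta> where "\<theta> = (\<lambda>x. r * \<omega> (incl b x))"
      note J\<theta> = J(1)[folded \<theta>_def]
      define T where "T = \<omega> ` (D \<inter> incl b ` J)"
      have T: "open T" "y \<in> T"
        unfolding T_def using is_chart_open_image[OF ca] openL_incl_image chart_open[OF J\<theta>] x J(2) by auto
      \<comment> \<open>Near \<open>y\<close> the function \<open>G\<close> is the global chart read
        in an oriented chart after a change of sign, which may flip the derivative but cannot
        annihilate it.\<close>
      have eq: "((f \<circ> inv_into J \<theta>) \<circ> (*) r) z = G z" if "z \<in> T" for z
      proof -
        from that obtain u where u: "u \<in> J" "z = \<omega> (incl b u)" by (auto simp: T_def)
        then have "r * z = \<theta> u" by (simp add: \<theta>_def)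
        then have "inv_into J \<theta> (r * z) = u"
          using chart_inj[OF J\<theta>] u by simp
        moreover have "inv_into D \<omega> z = incl b u"
          using u J(3) inj by auto
        ultimately show ?thesis by (simp add: G_def)
      qed
      have "Ck_on k T ((f \<circ> inv_into J \<theta>) \<circ> (*) r)"
        using chart_open_image[OF J\<theta>, of UNIV] Ck[OF J\<theta>]
        by (intro Ck_on_compose[OF T(1), of "\<theta> ` J"] Ck_on_scale) (auto simp: T_def \<theta>_def)
      then have G: "Ck_on k T G" by (rule Ck_on_eq) (rule eq)
      obtain d where d: "(f \<circ> inv_into J \<theta> has_real_derivative d) (at (\<theta> x))" "d \<noteq> 0"
        using der[OF J\<theta> J(2)] by blast
      have "\<theta> x = r * y" by (simp add: \<theta>_def x)
      moreover have "((*) r has_real_derivative r) (at y)"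
        by (auto intro!: derivative_eq_intros)
      ultimately have "((f \<circ> inv_into J \<theta>) \<circ> (*) r has_real_derivative d * r) (at y)"
        using d by (intro DERIV_chain) auto
      then have "(G has_real_derivative d * r) (at y)"
        by (rule has_field_derivative_transform_within_open[OF _ T]) (rule eq)
      moreover have "d * r \<noteq> 0"
        using d J(4) by auto
      ultimately show ?thesis using T G by blast
    qed
    have CkG: "Ck_on k S G"
      by (rule Ck_on_local[OF _ S]) (use loc in blast)
    have injG: "inj_on G S"
    proof (rule inj_onI)
      fix y z assume "y \<in> S" "z \<in> S" and eq: "G y = G z"
      then obtain u v where "incl b u \<in> D" "y = \<omega> (incl b u)" "incl b v \<in> D" "z = \<omega> (incl b v)"
        by (auto simp: S_def)
      with eq inj bij show "y = z"
        by (simp add: G_def bij_is_inj inj_eq)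
    qed
    have nz: "deriv G y \<noteq> 0" if "y \<in> S" for y
      using loc[OF that] DERIV_imp_deriv by fastforce
    have "Ck_on k (G ` S) (inv_into S G)"
      by (rule Ck_on_inv_into[OF S k CkG injG nz])
    moreover have "G ` S = (f \<circ> proj) ` (?W \<inter> D)"
      using inj by (force simp: S_def G_def)
    moreover have "inv_into S G y = (\<omega> \<circ> inv_into ?W (f \<circ> proj)) y" if "y \<in> (f \<circ> proj) ` (?W \<inter> D)" for y
    proof (rule inv_into_f_eq[OF injG])
      from that obtain x where x: "incl b x \<in> D" "y = f x" by auto
      have "inv_into ?W (f \<circ> proj) y = incl b (inv f y)"
        using inv_into_range_incl[of "f \<circ> proj" b] bij by (simp only: fp)
      also have "\<dots> = incl b x"
        using x bij by (simp add: bij_is_inj)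
      finally have e: "inv_into ?W (f \<circ> proj) y = incl b x" .
      show "(\<omega> \<circ> inv_into ?W (f \<circ> proj)) y \<in> S"
        using e x by (simp add: S_def)
      show "G ((\<omega> \<circ> inv_into ?W (f \<circ> proj)) y) = y"
        using e x inj by (simp add: G_def)
    qed
    ultimately have "Ck_on k ((f \<circ> proj) ` (?W \<inter> D)) (\<omega> \<circ> inv_into ?W (f \<circ> proj))"
      using Ck_on_eq[of k "(f \<circ> proj) ` (?W \<inter> D)" "inv_into S G"] by simp
    then have "Ck_rep k id ?c a"
      by (simp add: Ck_rep_def a)
    moreover have "Ck_rep k id a ?c"
      using CkG by (simp add: Ck_rep_def a S_def G_def)
    ultimately show ?thesis
      using compatible_iff[OF chart] ca a by blast
  qed
  moreover have "homeo0 f"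
    using bij cont by (simp add: homeo0_def f_def)
  ultimately show thesis
    using that by blast
qed

lemma minimal_atlas_exists:
  assumes k: "k \<ge> 1" and S: "is_structure k S"
  shows "\<exists>\<phi> \<psi>. minimal_atlas k \<phi> \<psi> \<and> {(UL, \<phi>), (VL, \<psi>)} \<in> S"
proof -
  obtain A where A: "is_atlas k A" "S = {B. is_atlas k B \<and> is_atlas k (A \<union> B)}"
    using S by (auto simp: is_structure_def)
  obtain f where f: "homeo0 f" "\<And>a. a \<in> A \<Longrightarrow> compatible k (UL, f \<circ> proj) a"
    unfolding UL_incl using atlas_line_chart[OF k A(1)] by metis
  obtain g where g: "homeo0 g" "\<And>a. a \<in> A \<Longrightarrow> compatible k (VL, g \<circ> proj) a"
    unfolding VL_incl using atlas_line_chart[OF k A(1)] by metis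
  let ?M = "{(UL, f \<circ> proj), (VL, g \<circ> proj)}"
  have pi: "h \<circ> proj \<circ> incl b = h" for h :: "real \<Rightarrow> real" and b by auto
  have charts: "is_chart c" if "c \<in> A \<union> ?M" for c
    using that A(1) f(1) g(1) is_chart_range_inclI[OF _ _ pi]
    by (auto simp: is_atlas_def UL_incl VL_incl homeo0_def)
  have compA: "compatible k c a" if "c \<in> A \<union> ?M" "a \<in> A" for c a
    using that A(1) f(2)[OF that(2)] g(2)[OF that(2)] by (auto simp: is_atlas_def)
  \<comment> \<open>The two new charts have been compared with \<open>A\<close> only; using
    \<open>A\<close> as the middle makes them compatible with each other.\<close>
  have comp: "compatible k c d" if "c \<in> A \<union> ?M" "d \<in> A \<union> ?M" for c d
    by (rule atlas_compatible_trans[OF A(1) charts[OF that(1)] compA[OF that(1)] charts[OF that(2)] compA[OF that(2)]])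
  have "UL \<union> VL = UNIV"
    using incl_exists by (auto simp: UL_incl VL_incl) (metis (full_types) rangeI)
  then have "is_atlas k ?M" "is_atlas k (A \<union> ?M)"
    unfolding is_atlas_def using charts comp A(1) by (auto simp: is_atlas_def)
  moreover have "(f \<circ> proj) ` UL = UNIV" "(g \<circ> proj) ` VL = UNIV"
    using f(1) g(1) by (auto simp: UL_incl VL_incl image_comp pi homeo0_def bij_def)
  ultimately show ?thesis
    using A(2) f(1) g(1)
    by (intro exI[of _ "f \<circ> proj"] exI[of _ "g \<circ> proj"])
       (auto simp: minimal_atlas_def homeo0_def orig_incl)
qed

section \<open>Double cosets\<close>

lemma UL_Int_VL: "UL \<inter> VL = incl b ` (- {0})"
  unfolding UL_incl VL_incl
proof (intro equalityI subsetI)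
  fix p assume "p \<in> range (incl True) \<inter> range (incl False)"
  then obtain x y where xy: "p = incl True x" "p = incl False y" by blast
  then have "x \<noteq> 0" by (auto simp: incl_eq_iff)
  moreover have "p = incl b x"
    using xy(1) \<open>x \<noteq> 0\<close> by (simp add: incl_eq_iff)
  ultimately show "p \<in> incl b ` (- {0})" by simp
next
  fix p assume "p \<in> incl b ` (- {0})"
  then obtain x where x: "x \<noteq> 0" "p = incl b x" by auto
  then have "p = incl True x" "p = incl False x" by (simp_all add: incl_eq_iff)
  then show "p \<in> range (incl True) \<inter> range (incl False)" by blast
qed

lemma homeo0_image_punctured: "homeo0 f \<Longrightarrow> f ` (- {0}) = - {0}"
  by (metis bij_image_Compl_eq homeo0_def image_empty image_insert)

lemma homeo0_inv_f: "homeo0 f \<Longrightarrow> inv f (f x) = x" and homeo0_f_inv: "homeo0 f \<Longrightarrow> f (inv f x) = x"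
  by (simp_all add: homeo0_def bij_is_inj bij_is_surj surj_f_inv_f)

text \<open>A nonzero coordinate comes from a nonzero parameter, where the two parametrisations
  coincide. Letting \<open>b\<close> vary covers both directions of the transition.\<close>

lemma Ck_rep_overlap:
  assumes P: "homeo0 (\<phi> \<circ> incl b)" and Q: "homeo0 (\<psi> \<circ> incl (\<not> b))"
  shows "Ck_rep k id (range (incl b), \<phi>) (range (incl (\<not> b)), \<psi>) \<longleftrightarrow>
    Ck_on k (- {0}) ((\<psi> \<circ> incl (\<not> b)) \<circ> inv (\<phi> \<circ> incl b))"
proof -
  have "range (incl b) \<inter> range (incl (\<not> b)) = incl b ` (- {0})"
    using UL_Int_VL[of b] by (cases b) (auto simp: UL_incl VL_incl)
  then have "\<phi> ` (range (incl b) \<inter> range (incl (\<not> b))) = (\<phi> \<circ> incl b) ` (- {0})"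
    by (simp add: image_comp)
  also have "\<dots> = - {0}"
    by (rule homeo0_image_punctured[OF P])
  finally have im: "\<phi> ` (range (incl b) \<inter> range (incl (\<not> b))) = - {0}" .
  have eq: "(\<psi> \<circ> inv_into (range (incl b)) \<phi>) y = ((\<psi> \<circ> incl (\<not> b)) \<circ> inv (\<phi> \<circ> incl b)) y" if "y \<in> - {0}" for y
  proof -
    have "inv (\<phi> \<circ> incl b) y \<noteq> 0"
      using homeo0_eq_0[OF homeo0_inv[OF P]] that by simp
    then have "incl b (inv (\<phi> \<circ> incl b) y) = incl (\<not> b) (inv (\<phi> \<circ> incl b) y)"
      by (simp add: incl_eq_iff)
    with P show ?thesis
      by (simp add: inv_into_range_incl homeo0_def)
  qed
  show ?thesis
    using Ck_on_cong[of "- {0}" "\<psi> \<circ> inv_into (range (incl b)) \<phi>" "(\<psi> \<circ> incl (\<not> b)) \<circ> inv (\<phi> \<circ> incl b)", OF eq]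
    by (simp add: Ck_rep_def im)
qed

text \<open>The dictionary from charts to real functions: the algebra of double cosets sees a
  minimal atlas only through \<open>\<phi> \<circ> incl True\<close> and
  \<open>\<psi> \<circ> incl False\<close>.\<close>

lemma minimal_atlas_iff:
  "minimal_atlas k \<phi> \<psi> \<longleftrightarrow> homeo0 (\<phi> \<circ> incl True) \<and> homeo0 (\<psi> \<circ> incl False) \<and>
    Ck_on k (- {0}) ((\<psi> \<circ> incl False) \<circ> inv (\<phi> \<circ> incl True)) \<and>
    Ck_on k (- {0}) ((\<phi> \<circ> incl True) \<circ> inv (\<psi> \<circ> incl False))"
    (is "_ \<longleftrightarrow> ?P \<and> ?Q \<and> ?A \<and> ?B")
proof
  assume m: "minimal_atlas k \<phi> \<psi>"
  then have charts: "is_chart (UL, \<phi>)" "is_chart (VL, \<psi>)"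
    and comp: "compatible k (UL, \<phi>) (VL, \<psi>)"
    by (auto simp: minimal_atlas_def is_atlas_def)
  have P: ?P and Q: ?Q
    using is_chart_range_inclD[of True \<phi>] is_chart_range_inclD[of False \<psi>] charts m
    by (auto simp: homeo0_def minimal_atlas_def UL_incl VL_incl orig_incl)
  with comp show "?P \<and> ?Q \<and> ?A \<and> ?B"
    unfolding compatible_iff[OF charts]
    using Ck_rep_overlap[of \<phi> True \<psi> k] Ck_rep_overlap[of \<psi> False \<phi> k] by (simp add: UL_incl VL_incl)
next
  assume *: "?P \<and> ?Q \<and> ?A \<and> ?B"
  then have P: ?P and Q: ?Q by auto
  have charts: "is_chart (UL, \<phi>)" "is_chart (VL, \<psi>)"
    using P Q is_chart_range_inclI[OF _ _ refl] by (auto simp: homeo0_def UL_incl VL_incl)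
  have "compatible k (UL, \<phi>) (VL, \<psi>)"
    unfolding compatible_iff[OF charts]
    using * Ck_rep_overlap[of \<phi> True \<psi> k] Ck_rep_overlap[of \<psi> False \<phi> k] by (simp add: UL_incl VL_incl)
  moreover have "UL \<union> VL = UNIV"
    using incl_exists by (auto simp: UL_incl VL_incl) (metis (full_types) rangeI)
  ultimately have "is_atlas k {(UL, \<phi>), (VL, \<psi>)}"
    using charts compatible_refl compatible_sym[of "(UL, \<phi>)" "(VL, \<psi>)" k] by (simp add: is_atlas_def)
  moreover have "\<phi> ` UL = UNIV" "\<psi> ` VL = UNIV"
    using P Q by (auto simp: homeo0_def bij_def UL_incl VL_incl image_comp)
  moreover have "\<phi> orig = 0" "\<psi> orig' = 0"
    using P Q by (auto simp: homeo0_def orig_incl)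
  ultimately show "minimal_atlas k \<phi> \<psi>"
    by (simp add: minimal_atlas_def)
qed

text \<open>Both real functions fix 0, so their composition already takes the value that
  \<open>gamma\<close> prescribes there; without the case distinction, inverses can be computed
  algebraically.\<close>

lemma gamma_eq:
  assumes P: "homeo0 (\<phi> \<circ> incl True)" and Q: "homeo0 (\<psi> \<circ> incl False)"
  shows "gamma \<phi> \<psi> = (\<psi> \<circ> incl False) \<circ> inv (\<phi> \<circ> incl True)"
proof
  fix y
  show "gamma \<phi> \<psi> y = ((\<psi> \<circ> incl False) \<circ> inv (\<phi> \<circ> incl True)) y"
  proof (cases "y = 0")
    case True
    with homeo0_inv[OF P] Q show ?thesis by (simp add: gamma_def homeo0_def)
  next
    case False
    then have "inv (\<phi> \<circ> incl True) y \<noteq> 0"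
      using homeo0_eq_0[OF homeo0_inv[OF P]] by simp
    then have "incl True (inv (\<phi> \<circ> incl True) y) = incl False (inv (\<phi> \<circ> incl True) y)"
      by (simp add: incl_eq_iff)
    with P False show ?thesis
      by (simp add: gamma_def UL_incl inv_into_range_incl homeo0_def)
  qed
qed

lemma Hk_iff: "h \<in> Hk k \<longleftrightarrow> homeo0 h \<and> Ck_on k (- {0}) h \<and> Ck_on k (- {0}) (inv h)"
proof -
  have "(\<exists>g. homeomorphism UNIV UNIV h g) \<and> h 0 = 0 \<longleftrightarrow> homeo0 h"
  proof
    assume "(\<exists>g. homeomorphism UNIV UNIV h g) \<and> h 0 = 0"
    then obtain g where g: "homeomorphism UNIV UNIV h g" "h 0 = 0" by blast
    then have "bij h"
      by (intro bijI injI) (metis UNIV_I homeomorphism_apply1, auto simp: homeomorphism_def)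
    with g show "homeo0 h"
      by (simp add: homeo0_def homeomorphism_def)
  next
    assume h: "homeo0 h"
    have "homeomorphism UNIV UNIV h (inv h)"
      using h homeo0_inv[OF h]
      by (auto simp: homeomorphism_def homeo0_def bij_is_inj bij_is_surj surj_f_inv_f bij_imp_bij_inv)
    with h show "(\<exists>g. homeomorphism UNIV UNIV h g) \<and> h 0 = 0"
      by (auto simp: homeo0_def)
  qed
  moreover have "Ck_diffeo k (- {0}) (- {0}) h \<longleftrightarrow> Ck_on k (- {0}) h \<and> Ck_on k (- {0}) (inv h)" if h: "homeo0 h"
  proof -
    have inj: "inj_on h (- {0})"
      using h by (auto simp: homeo0_def bij_def intro: inj_on_subset)
    have eq: "inv_into (- {0}) h y = inv h y" if "y \<in> - {0}" for y
      by (rule inv_into_f_eq[OF inj])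
         (use that homeo0_eq_0[OF homeo0_inv[OF h]] homeo0_f_inv[OF h] in auto)
    show ?thesis
      using inj homeo0_image_punctured[OF h] Ck_on_cong[of "- {0}" "inv_into (- {0}) h" "inv h", OF eq]
      by (simp add: Ck_diffeo_def bij_betw_def)
  qed
  ultimately show ?thesis
    unfolding Hk_def by blast
qed

section \<open>The group D^k and its double cosets\<close>

lemma Dk_iff: "h \<in> Dk k \<longleftrightarrow> homeo0 h \<and> Ck_on k UNIV h \<and> Ck_on k UNIV (inv h)"
  unfolding Dk_def Ck_diffeo_def homeo0_def using Ck_on_imp_continuous[of k UNIV h] by auto

lemma Dk_homeo0: "h \<in> Dk k \<Longrightarrow> homeo0 h"
  by (simp add: Dk_iff)

lemma homeo0_inv_comp: "homeo0 f \<Longrightarrow> homeo0 g \<Longrightarrow> inv (f \<circ> g) = inv g \<circ> inv f"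
  by (simp add: o_inv_distrib homeo0_def)

lemma homeo0_inv_inv: "homeo0 f \<Longrightarrow> inv (inv f) = f"
  by (simp add: inv_inv_eq homeo0_def)

lemma Dk_id: "id \<in> Dk k"
  using Ck_on_id[of k UNIV] by (simp add: Dk_iff homeo0_id id_def[symmetric])

lemma Dk_inv: "h \<in> Dk k \<Longrightarrow> inv h \<in> Dk k"
  by (simp add: Dk_iff homeo0_inv homeo0_inv_inv)

lemma Dk_comp:
  assumes "f \<in> Dk k" "g \<in> Dk k"
  shows "f \<circ> g \<in> Dk k"
proof -
  have "Ck_on k UNIV (f \<circ> g)" "Ck_on k UNIV (inv g \<circ> inv f)"
    using assms by (auto simp: Dk_iff intro!: Ck_on_compose[OF open_UNIV open_UNIV])
  with assms show ?thesis
    by (simp add: Dk_iff homeo0_comp homeo0_inv_comp)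
qed

lemma dcosetI: "a \<in> Dk k \<Longrightarrow> b \<in> Dk k \<Longrightarrow> a \<circ> h \<circ> b \<in> dcoset k h"
  unfolding dcoset_def by blast

lemma dcoset_refl: "h \<in> dcoset k h"
  using dcosetI[OF Dk_id Dk_id] by simp

lemma dcoset_trans: 
  assumes "g \<in> dcoset k h" "f \<in> dcoset k g" shows "f \<in> dcoset k h"
proof -
  obtain a b c d where *: "a \<in> Dk k" "b \<in> Dk k" "g = a \<circ> h \<circ> b" "c \<in> Dk k" "d \<in> Dk k" "f = c \<circ> g \<circ> d"
    using assms by (auto simp: dcoset_def)
  then have "f = (c \<circ> a) \<circ> h \<circ> (b \<circ> d)" by (simp add: comp_assoc)
  with * show ?thesis
    using dcosetI[OF Dk_comp Dk_comp] by metis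
qed

lemma dcoset_sym:
  assumes "g \<in> dcoset k h" shows "h \<in> dcoset k g"
proof -
  obtain a b where *: "a \<in> Dk k" "b \<in> Dk k" "g = a \<circ> h \<circ> b"
    using assms by (auto simp: dcoset_def)
  have "h = inv a \<circ> g \<circ> inv b"
    using Dk_homeo0[OF *(1)] Dk_homeo0[OF *(2)] by (auto simp: *(3) homeo0_inv_f homeo0_f_inv)
  with * show ?thesis
    using dcosetI[OF Dk_inv Dk_inv] by metis
qed

lemma dcoset_eq_iff: "dcoset k g = dcoset k h \<longleftrightarrow> h \<in> dcoset k g"
  using dcoset_refl dcoset_trans dcoset_sym by blast

lemma dcoset_inv:
  assumes h: "homeo0 h" and "g \<in> dcoset k h"
  shows "inv g \<in> dcoset k (inv h)"
proof -
  obtain a b where *: "a \<in> Dk k" "b \<in> Dk k" "g = a \<circ> h \<circ> b"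
    using assms by (auto simp: dcoset_def)
  then have "inv g = inv b \<circ> inv h \<circ> inv a"
    using h by (simp add: homeo0_inv_comp homeo0_comp Dk_homeo0 comp_assoc)
  with * show ?thesis
    using dcosetI[OF Dk_inv Dk_inv] by metis
qed

text \<open>Inversion carries the double coset of \<open>h\<close> onto that of
  \<open>inv h\<close>. So if the two pairs of double cosets share one member, the inverted members
  agree as well and the unions coincide.\<close>

lemma pm_dcoset_eq_iff:
  assumes g: "homeo0 g" and h: "homeo0 h"
  shows "pm_dcoset k g = pm_dcoset k h \<longleftrightarrow> h \<in> dcoset k g \<or> inv h \<in> dcoset k g"
proof
  assume "pm_dcoset k g = pm_dcoset k h"
  then have "h \<in> dcoset k g \<or> h \<in> dcoset k (inv g)"
    using dcoset_refl[of h k] by (auto simp: pm_dcoset_def)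
  then show "h \<in> dcoset k g \<or> inv h \<in> dcoset k g"
    using dcoset_inv[OF homeo0_inv[OF g], of h k] homeo0_inv_inv[OF g] by auto
next
  assume "h \<in> dcoset k g \<or> inv h \<in> dcoset k g"
  then show "pm_dcoset k g = pm_dcoset k h"
  proof
    assume "h \<in> dcoset k g"
    then have "dcoset k g = dcoset k h" "dcoset k (inv g) = dcoset k (inv h)"
      using dcoset_inv[OF g] by (simp_all add: dcoset_eq_iff)
    then show ?thesis by (simp add: pm_dcoset_def)
  next
    assume "inv h \<in> dcoset k g"
    then have "dcoset k g = dcoset k (inv h)" "dcoset k (inv g) = dcoset k h"
      using dcoset_inv[OF g, of "inv h" k] homeo0_inv_inv[OF h] by (simp_all add: dcoset_eq_iff)
    then show ?thesis by (simp add: pm_dcoset_def Un_commute)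
  qed
qed

lemma dcoset_iff_intertwiner:
  assumes "homeo0 X" "homeo0 Y" "homeo0 P" "homeo0 Q"
  shows "Q \<circ> inv P \<in> dcoset k (Y \<circ> inv X) \<longleftrightarrow>
    (\<exists>\<eta>. homeo0 \<eta> \<and> P \<circ> \<eta> \<circ> inv X \<in> Dk k \<and> Q \<circ> \<eta> \<circ> inv Y \<in> Dk k)"
proof
  assume "Q \<circ> inv P \<in> dcoset k (Y \<circ> inv X)"
  then obtain a c where ac: "a \<in> Dk k" "c \<in> Dk k" and eq: "Q \<circ> inv P = a \<circ> (Y \<circ> inv X) \<circ> c"
    by (auto simp: dcoset_def)
  note inv = assms Dk_homeo0[OF ac(1)] Dk_homeo0[OF ac(2)]
  \<comment> \<open>Obtained by solving \<open>P \<circ> \<eta> \<circ> inv X = inv c\<close>; the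
    coset equation then forces the other expression to be \<open>a\<close>.\<close>
  define \<eta> where "\<eta> = inv P \<circ> inv c \<circ> X"
  have "homeo0 \<eta>"
    unfolding \<eta>_def by (intro homeo0_comp homeo0_inv inv)
  moreover have "P \<circ> \<eta> \<circ> inv X = inv c"
    by (auto simp: \<eta>_def homeo0_f_inv inv)
  moreover have "Q \<circ> \<eta> \<circ> inv Y = a"
  proof -
    have "Q \<circ> \<eta> \<circ> inv Y = (Q \<circ> inv P) \<circ> (inv c \<circ> X \<circ> inv Y)"
      by (simp add: \<eta>_def comp_assoc)
    also have "\<dots> = a"
      unfolding eq by (auto simp: homeo0_f_inv homeo0_inv_f inv)
    finally show ?thesis .
  qed
  ultimately show "\<exists>\<eta>. homeo0 \<eta> \<and> P \<circ> \<eta> \<circ> inv X \<in> Dk k \<and> Q \<circ> \<eta> \<circ> inv Y \<in> Dk k"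
    using ac Dk_inv by auto
next
  assume "\<exists>\<eta>. homeo0 \<eta> \<and> P \<circ> \<eta> \<circ> inv X \<in> Dk k \<and> Q \<circ> \<eta> \<circ> inv Y \<in> Dk k"
  then obtain \<eta> where \<eta>: "homeo0 \<eta>" "P \<circ> \<eta> \<circ> inv X \<in> Dk k" "Q \<circ> \<eta> \<circ> inv Y \<in> Dk k"
    by blast
  note inv = assms \<eta>(1)
  have "inv (P \<circ> \<eta> \<circ> inv X) = X \<circ> inv \<eta> \<circ> inv P"
    by (simp add: homeo0_inv_comp homeo0_comp homeo0_inv homeo0_inv_inv inv comp_assoc)
  then have "(Q \<circ> \<eta> \<circ> inv Y) \<circ> (Y \<circ> inv X) \<circ> inv (P \<circ> \<eta> \<circ> inv X) = Q \<circ> inv P"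
    by (auto simp: homeo0_f_inv homeo0_inv_f inv)
  then show "Q \<circ> inv P \<in> dcoset k (Y \<circ> inv X)"
    using dcosetI[OF \<eta>(3) Dk_inv[OF \<eta>(2)]] by metis
qed

section \<open>Homeomorphisms and diffeomorphisms\<close>

text \<open>Since \<open>b = s\<close> negates \<open>b\<close> exactly when \<open>s\<close> is false, \<open>lifts True\<close> describes the maps fixing
  both origins and \<open>lifts False\<close> those exchanging them.\<close>

definition lifts :: "bool \<Rightarrow> (real \<Rightarrow> real) \<Rightarrow> (real option \<Rightarrow> real option) \<Rightarrow> bool" where
  "lifts s \<eta> h \<longleftrightarrow> (\<forall>b x. h (incl b x) = incl (b = s) (\<eta> x))"

lemma liftsD: "lifts s \<eta> h \<Longrightarrow> h (incl b x) = incl (b = s) (\<eta> x)"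
  by (simp add: lifts_def)

lemma lifts_exists:
  assumes "homeo0 \<eta>" shows "\<exists>h. lifts s \<eta> h"
proof -
  \<comment> \<open>Every point except the second origin is \<open>incl True (proj p)\<close>. Off 0
    the parametrisations agree, so these two clauses settle both values of \<open>b\<close>.\<close>
  define h where "h p = (if p = incl False 0 then incl (False = s) 0 else incl (True = s) (\<eta> (proj p)))" for p
  have "h (incl b x) = incl (b = s) (\<eta> x)" for b x
    using assms homeo0_eq_0[OF assms, of x] by (cases "x = 0"; cases b) (auto simp: h_def incl_eq_iff)
  then show ?thesis
    unfolding lifts_def by blast
qed

lemma lifts_bij:
  assumes \<eta>: "homeo0 \<eta>" and h: "lifts s \<eta> h"
  shows "bij h"
proof (rule bijI)
  show "inj h"
  proof (rule injI)
    fix p q assume eq: "h p = h q"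
    obtain b x c y where pq: "p = incl b x" "q = incl c y"
      using incl_exists by metis
    have "\<eta> x = \<eta> y \<longleftrightarrow> x = y"
      using \<eta> by (simp add: homeo0_def bij_is_inj inj_eq)
    then show "p = q"
      using eq homeo0_eq_0[OF \<eta>] by (auto simp: pq liftsD[OF h] incl_eq_iff)
  qed
  show "surj h"
  proof (rule surjI)
    fix p
    show "h (SOME q. h q = p) = p"
    proof (rule someI_ex)
      obtain b x where "p = incl b x" using incl_exists by metis
      then have "h (incl (b = s) (inv \<eta> x)) = p"
        by (cases s) (simp_all add: liftsD[OF h] homeo0_f_inv[OF \<eta>])
      then show "\<exists>q. h q = p" by blast
    qed
  qed
qed

text \<open>The inverse has the same \<open>s\<close>, because b \<mapsto> (b = s) is an involution
  on truth values.\<close>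

lemma lifts_inv:
  assumes \<eta>: "homeo0 \<eta>" and h: "lifts s \<eta> h"
  shows "lifts s (inv \<eta>) (inv h)"
  unfolding lifts_def
proof (intro allI)
  fix b x
  have "h (incl (b = s) (inv \<eta> x)) = incl b x"
    by (cases s) (simp_all add: liftsD[OF h] homeo0_f_inv[OF \<eta>])
  then show "inv h (incl b x) = incl (b = s) (inv \<eta> x)"
    using lifts_bij[OF assms] by (metis bij_is_inj inv_f_f)
qed

lemma lifts_continuous:
  assumes \<eta>: "homeo0 \<eta>" and h: "lifts s \<eta> h"
  shows "continuous_map TL TL h"
  unfolding continuous_map_TL
proof (intro allI impI)
  fix V assume V: "openL V"
  show "openL (h -` V)"
    unfolding openL_iff
  proof
    fix b
    have "incl b -` (h -` V) = \<eta> -` (incl (b = s) -` V)"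
      by (auto simp: liftsD[OF h])
    moreover have "open (incl (b = s) -` V)"
      using V openL_iff by blast
    ultimately show "open (incl b -` (h -` V))"
      using \<eta> continuous_on_open_vimage[OF open_UNIV, of \<eta>] by (auto simp: homeo0_def)
  qed
qed

lemma lifts_homeomorphic:
  assumes \<eta>: "homeo0 \<eta>" and h: "lifts s \<eta> h"
  shows "homeomorphic_map TL TL h"
proof -
  have "homeomorphic_maps TL TL h (inv h)"
    using lifts_continuous[OF assms] lifts_continuous[OF homeo0_inv[OF \<eta>] lifts_inv[OF assms]] lifts_bij[OF assms]
    by (simp add: homeomorphic_maps_def bij_is_inj bij_is_surj surj_f_inv_f)
  then show ?thesis
    by (rule homeomorphic_maps_imp_map)
qed

section \<open>Homeomorphisms and the pair of origins\<close>

definition inseparable :: "real option \<Rightarrow> real option \<Rightarrow> bool" where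
  "inseparable p q \<longleftrightarrow> p \<noteq> q \<and> (\<forall>U V. openL U \<longrightarrow> openL V \<longrightarrow> p \<in> U \<longrightarrow> q \<in> V \<longrightarrow> U \<inter> V \<noteq> {})"

lemma inseparable_origins: "inseparable (incl b 0) (incl (\<not> b) 0)"
  unfolding inseparable_def
proof (intro conjI allI impI)
  show "incl b 0 \<noteq> incl (\<not> b) 0" by (simp add: incl_eq_iff)
  fix U V assume *: "openL U" "openL V" "incl b 0 \<in> U" "incl (\<not> b) 0 \<in> V"
  let ?W = "incl b -` U \<inter> incl (\<not> b) -` V"
  have "open ?W" "0 \<in> ?W"
    using * by (auto simp: openL_iff)
  then obtain e where e: "e > 0" "ball 0 e \<subseteq> ?W"
    by (meson open_contains_ball)
  \<comment> \<open>At a nonzero common parameter the parametrisations agree, which gives a common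
    point of \<open>U\<close> and \<open>V\<close>.\<close>
  then have "e / 2 \<in> ?W" by (auto simp: subset_iff dist_real_def)
  moreover have "incl b (e / 2) = incl (\<not> b) (e / 2)"
    using e by (simp add: incl_eq_iff)
  ultimately show "U \<inter> V \<noteq> {}" by auto
qed

lemma inseparable_imp_origins:
  assumes "inseparable p q"
  shows "\<exists>s. p = incl s 0 \<and> q = incl (\<not> s) 0"
proof -
  obtain b x c y where pq: "p = incl b x" "q = incl c y"
    using incl_exists by metis
  \<comment> \<open>Different coordinates can be separated on the real line, and preimages under
    \<open>proj\<close> then separate the points. Distinct points with equal coordinates are the
    origins.\<close>
  have "x = y"
  proof (rule ccontr)
    assume "x \<noteq> y"
    then obtain U V where UV: "open U" "open V" "x \<in> U" "y \<in> V" "U \<inter> V = {}"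
      using hausdorff[OF \<open>x \<noteq> y\<close>] by blast
    then have "openL (proj -` U)" "openL (proj -` V)" "p \<in> proj -` U" "q \<in> proj -` V" "proj -` U \<inter> proj -` V = {}"
      by (auto simp: openL_proj_vimage pq)
    with assms show False
      unfolding inseparable_def by blast
  qed
  moreover have "p \<noteq> q" using assms by (simp add: inseparable_def)
  ultimately have "x = 0" "y = 0" "c = (\<not> b)"
    by (auto simp: pq incl_eq_iff)
  with pq show ?thesis by blast
qed

lemma homeomorphic_imp_lifts:
  assumes "homeomorphic_map TL TL h"
  shows "\<exists>s \<eta>. homeo0 \<eta> \<and> lifts s \<eta> h"
proof -
  have h: "bij h" and cont: "\<And>V. openL V \<Longrightarrow> openL (h -` V)"
    using assms by (auto simp: homeomorphic_eq_everything_map continuous_map_TL bij_def)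
  have "inseparable (h (incl True 0)) (h (incl False 0))"
    unfolding inseparable_def
  proof (intro conjI allI impI)
    show "h (incl True 0) \<noteq> h (incl False 0)"
      using h by (simp add: bij_is_inj inj_eq incl_eq_iff)
    fix U V assume *: "openL U" "openL V" "h (incl True 0) \<in> U" "h (incl False 0) \<in> V"
    then have "h -` U \<inter> h -` V \<noteq> {}"
      using inseparable_origins[of True] cont unfolding inseparable_def by auto
    then show "U \<inter> V \<noteq> {}" by auto
  qed
  then obtain s where s: "h (incl True 0) = incl s 0" "h (incl False 0) = incl (\<not> s) 0"
    using inseparable_imp_origins by blast
  \<comment> \<open>Read off on one line, \<open>\<eta>\<close> determines \<open>h\<close> on the
    other too, since the lines share all points except the origins.\<close>
  define \<eta> where "\<eta> = proj \<circ> h \<circ> incl True"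
  have \<eta>0: "\<eta> 0 = 0" by (simp add: \<eta>_def s)
  \<comment> \<open>Both origins are already images of origins, so by injectivity no other point is
    sent to one.\<close>
  have nz: "proj (h (incl b x)) \<noteq> 0" if "x \<noteq> 0" for b x
  proof
    assume "proj (h (incl b x)) = 0"
    then obtain c where "h (incl b x) = incl c 0"
      by (metis incl_exists proj_incl)
    then have "h (incl b x) = h (incl (c = s) 0)"
      using s by (cases c; cases s) auto
    then show False
      using h that by (simp add: bij_is_inj inj_eq incl_eq_iff)
  qed
  have L: "h (incl b x) = incl (b = s) (\<eta> x)" for b x
  proof (cases "x = 0")
    case True
    then show ?thesis using s \<eta>0 by (cases b) auto
  next
    case False
    then have "incl b x = incl True x" by (simp add: incl_eq_iff)
    with nz[OF False, of True] show ?thesis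
      by (simp add: \<eta>_def incl_proj)
  qed
  then have lift: "lifts s \<eta> h" by (simp add: lifts_def)
  have "inj \<eta>"
  proof (rule injI)
    fix x y assume "\<eta> x = \<eta> y"
    then have "h (incl True x) = h (incl True y)" by (simp add: L)
    then show "x = y" using h by (simp add: bij_is_inj inj_eq incl_eq_iff)
  qed
  moreover have "surj \<eta>"
  proof -
    have "\<exists>x. t = \<eta> x" for t
    proof -
      obtain p where "h p = incl True t" using h by (metis bij_pointE)
      moreover obtain b x where "p = incl b x" using incl_exists by metis
      ultimately have "t = \<eta> x" using L by (metis proj_incl)
      then show ?thesis by blast
    qed
    then show ?thesis by (auto simp: surj_def)
  qed
  moreover have "continuous_on UNIV \<eta>"
    unfolding continuous_on_open_vimage[OF open_UNIV]
  proof (intro allI impI)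
    fix B :: "real set" assume "open B"
    then have "openL (h -` (proj -` B))" by (intro cont openL_proj_vimage)
    then have "open (incl True -` (h -` (proj -` B)))" by (simp add: openL_iff)
    moreover have "incl True -` (h -` (proj -` B)) = \<eta> -` B \<inter> UNIV"
      by (auto simp: \<eta>_def)
    ultimately show "open (\<eta> -` B \<inter> UNIV)" by simp
  qed
  ultimately have "homeo0 \<eta>" using \<eta>0 by (simp add: homeo0_def bij_def)
  with lift show ?thesis by blast
qed

section \<open>Diffeomorphisms in terms of real functions\<close>

lemma Ck_rep_lifts:
  assumes h: "lifts s \<eta> h" and P: "homeo0 (\<phi> \<circ> incl b)"
  shows "Ck_rep k h (range (incl b), \<phi>) (range (incl (b = s)), \<psi>) \<longleftrightarrow>
    Ck_on k UNIV (\<psi> \<circ> incl (b = s) \<circ> \<eta> \<circ> inv (\<phi> \<circ> incl b))"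
proof -
  have "range (incl b) \<inter> h -` range (incl (b = s)) = range (incl b)"
    by (auto simp: liftsD[OF h])
  moreover have "\<phi> ` range (incl b) = UNIV"
    using P by (simp add: homeo0_def bij_def image_comp)
  moreover have "\<psi> \<circ> h \<circ> inv_into (range (incl b)) \<phi> = \<psi> \<circ> incl (b = s) \<circ> \<eta> \<circ> inv (\<phi> \<circ> incl b)"
    using P by (auto simp: inv_into_range_incl homeo0_def liftsD[OF h])
  ultimately show ?thesis
    by (simp add: Ck_rep_def)
qed

text \<open>Smoothness over all pairs of charts of the two structures reduces to two pairs: around a
  point of line \<open>b\<close>, the given charts on that line and on its image, line
  \<open>b = s\<close>, can be interposed.\<close>

lemma Ck_map_lifts_iff:
  assumes S: "is_structure k S1" "is_structure k S2"
    and \<Phi>1: "\<And>b. (range (incl b), \<Phi>1 b) \<in> \<Union>S1" "\<And>b. homeo0 (\<Phi>1 b \<circ> incl b)"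
    and \<Phi>2: "\<And>b. (range (incl b), \<Phi>2 b) \<in> \<Union>S2"
    and \<eta>: "homeo0 \<eta>" and h: "lifts s \<eta> h"
  shows "Ck_map k S1 S2 h \<longleftrightarrow>
    (\<forall>b. Ck_on k UNIV (\<Phi>2 (b = s) \<circ> incl (b = s) \<circ> \<eta> \<circ> inv (\<Phi>1 b \<circ> incl b)))"
proof -
  have "Ck_map k S1 S2 h \<longleftrightarrow>
     (\<forall>b. Ck_rep k h (range (incl b), \<Phi>1 b) (range (incl (b = s)), \<Phi>2 (b = s)))"
  proof
    assume "Ck_map k S1 S2 h"
    then show "\<forall>b. Ck_rep k h (range (incl b), \<Phi>1 b) (range (incl (b = s)), \<Phi>2 (b = s))"
      using \<Phi>1(1) \<Phi>2 by (simp only: Ck_map_iff_rep) blast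
  next
    assume *: "\<forall>b. Ck_rep k h (range (incl b), \<Phi>1 b) (range (incl (b = s)), \<Phi>2 (b = s))"
    show "Ck_map k S1 S2 h"
      unfolding Ck_map_iff_rep
    proof (intro ballI)
      fix c d assume c: "c \<in> \<Union>S1" and d: "d \<in> \<Union>S2"
      note chart = structure_charts(1)[OF S(1) c c] structure_charts(1)[OF S(2) d d]
      show "Ck_rep k h c d"
      proof (rule Ck_rep_change_charts[OF chart lifts_continuous[OF \<eta> h]])
        fix x
        obtain b u where x: "x = incl b u" using incl_exists by metis
        let ?c = "(range (incl b), \<Phi>1 b)" and ?d = "(range (incl (b = s)), \<Phi>2 (b = s))"
        have cc: "is_chart ?c" "compatible k c ?c"
          using structure_charts[OF S(1)] c \<Phi>1(1) by blast+
        have dd: "is_chart ?d" "compatible k ?d d"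
          using structure_charts[OF S(2)] d \<Phi>2 by blast+
        show "\<exists>c' d'. is_chart c' \<and> is_chart d' \<and> x \<in> fst c' \<and> h x \<in> fst d' \<and>
          Ck_rep k id c c' \<and> Ck_rep k id d' d \<and> Ck_rep k h c' d'"
          using cc dd * compatible_iff[OF chart(1) cc(1)] compatible_iff[OF dd(1) chart(2)]
          by (intro exI[of _ ?c] exI[of _ ?d]) (auto simp: x liftsD[OF h])
      qed
    qed
  qed
  then show ?thesis
    by (simp only: Ck_rep_lifts[OF h \<Phi>1(2)])
qed

lemma Ck_diffeo_L_lifts_iff:
  assumes S: "is_structure k S1" "is_structure k S2"
    and \<Phi>1: "\<And>b. (range (incl b), \<Phi>1 b) \<in> \<Union>S1" "\<And>b. homeo0 (\<Phi>1 b \<circ> incl b)"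
    and \<Phi>2: "\<And>b. (range (incl b), \<Phi>2 b) \<in> \<Union>S2" "\<And>b. homeo0 (\<Phi>2 b \<circ> incl b)"
    and \<eta>: "homeo0 \<eta>" and h: "lifts s \<eta> h"
  shows "Ck_diffeo_L k S1 S2 h \<longleftrightarrow>
    (\<forall>b. \<Phi>2 (b = s) \<circ> incl (b = s) \<circ> \<eta> \<circ> inv (\<Phi>1 b \<circ> incl b) \<in> Dk k)"
proof -
  let ?a = "\<lambda>b. \<Phi>2 (b = s) \<circ> incl (b = s) \<circ> \<eta> \<circ> inv (\<Phi>1 b \<circ> incl b)"
  have homeo: "homeo0 (?a b)" for b
    using \<Phi>1(2) \<Phi>2(2) \<eta> by (intro homeo0_comp homeo0_inv)
  have inv: "\<Phi>1 b \<circ> incl b \<circ> inv \<eta> \<circ> inv (\<Phi>2 (b = s) \<circ> incl (b = s)) = inv (?a b)" for b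
    using homeo0_inv_comp[OF homeo0_comp[OF \<Phi>2(2)[of "b = s"] \<eta>] homeo0_inv[OF \<Phi>1(2)[of b]]]
      homeo0_inv_comp[OF \<Phi>2(2)[of "b = s"] \<eta>] homeo0_inv_inv[OF \<Phi>1(2)[of b]]
    by (simp only: comp_assoc)
  have "Ck_map k S2 S1 (inv h) \<longleftrightarrow>
      (\<forall>b. Ck_on k UNIV (\<Phi>1 (b = s) \<circ> incl (b = s) \<circ> inv \<eta> \<circ> inv (\<Phi>2 b \<circ> incl b)))"
    by (rule Ck_map_lifts_iff[OF S(2,1) \<Phi>2 \<Phi>1(1) homeo0_inv[OF \<eta>] lifts_inv[OF \<eta> h]])
  \<comment> \<open>Reindexing by the involution b \<mapsto> (b = s) makes each expression the
    inverse of one for \<open>h\<close>.\<close>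
  also have "\<dots> \<longleftrightarrow> (\<forall>b. Ck_on k UNIV (\<Phi>1 b \<circ> incl b \<circ> inv \<eta> \<circ> inv (\<Phi>2 (b = s) \<circ> incl (b = s))))"
    by (cases s) (auto simp: all_bool_eq)
  also have "\<dots> \<longleftrightarrow> (\<forall>b. Ck_on k UNIV (inv (?a b)))"
    by (simp only: inv)
  finally show ?thesis
    using homeo lifts_homeomorphic[OF \<eta> h] Ck_map_lifts_iff[OF S \<Phi>1 \<Phi>2(1) \<eta> h]
    by (auto simp only: Ck_diffeo_L_def Dk_iff)
qed

lemma diffeo_classes:
  assumes S: "is_structure k S1" "is_structure k S2"
    and m1: "minimal_atlas k \<phi>1 \<psi>1" "{(UL, \<phi>1), (VL, \<psi>1)} \<in> S1"
    and m2: "minimal_atlas k \<phi>2 \<psi>2" "{(UL, \<phi>2), (VL, \<psi>2)} \<in> S2"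
  shows "diffeomorphic_fix k S1 S2 \<longleftrightarrow> gamma \<phi>2 \<psi>2 \<in> dcoset k (gamma \<phi>1 \<psi>1)"
    and "diffeomorphic k S1 S2 \<longleftrightarrow>
      gamma \<phi>2 \<psi>2 \<in> dcoset k (gamma \<phi>1 \<psi>1) \<or> inv (gamma \<phi>2 \<psi>2) \<in> dcoset k (gamma \<phi>1 \<psi>1)"
proof -
  define \<Phi>1 where "\<Phi>1 b = (if b then \<phi>1 else \<psi>1)" for b
  define \<Phi>2 where "\<Phi>2 b = (if b then \<phi>2 else \<psi>2)" for b
  have c1: "(range (incl b), \<Phi>1 b) \<in> \<Union>S1" for b
    using m1(2) by (cases b) (auto simp: \<Phi>1_def UL_incl VL_incl)
  have c2: "(range (incl b), \<Phi>2 b) \<in> \<Union>S2" for b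
    using m2(2) by (cases b) (auto simp: \<Phi>2_def UL_incl VL_incl)
  have h1: "homeo0 (\<Phi>1 b \<circ> incl b)" and h2: "homeo0 (\<Phi>2 b \<circ> incl b)" for b
    using m1(1) m2(1) by (cases b; simp add: \<Phi>1_def \<Phi>2_def minimal_atlas_iff)+
  define P1 where "P1 b = \<Phi>1 b \<circ> incl b" for b
  define P2 where "P2 b = \<Phi>2 b \<circ> incl b" for b
  have g1: "gamma \<phi>1 \<psi>1 = P1 False \<circ> inv (P1 True)" and g2: "gamma \<phi>2 \<psi>2 = P2 False \<circ> inv (P2 True)"
    using m1(1) m2(1) gamma_eq unfolding P1_def P2_def \<Phi>1_def \<Phi>2_def by (simp_all add: minimal_atlas_iff)
  have "inv (gamma \<phi>2 \<psi>2) = P2 True \<circ> inv (P2 False)"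
    using h2 by (simp add: g2 P2_def homeo0_inv_comp homeo0_inv homeo0_inv_inv)
  note g2' = this
  have *: "(\<exists>h \<eta>. Ck_diffeo_L k S1 S2 h \<and> homeo0 \<eta> \<and> lifts s \<eta> h) \<longleftrightarrow>
      (\<exists>\<eta>. homeo0 \<eta> \<and> P2 s \<circ> \<eta> \<circ> inv (P1 True) \<in> Dk k \<and> P2 (\<not> s) \<circ> \<eta> \<circ> inv (P1 False) \<in> Dk k)" for s
  proof -
    have "Ck_diffeo_L k S1 S2 h \<longleftrightarrow>
       P2 s \<circ> \<eta> \<circ> inv (P1 True) \<in> Dk k \<and> P2 (\<not> s) \<circ> \<eta> \<circ> inv (P1 False) \<in> Dk k"
      if "homeo0 \<eta>" "lifts s \<eta> h" for h \<eta>
      using Ck_diffeo_L_lifts_iff[OF S c1 h1 c2 h2 that]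
      by (simp add: all_bool_eq P1_def P2_def conj_commute)
    then show ?thesis
      using lifts_exists by blast
  qed
  \<comment> \<open>For s = True the left factor pair is \<open>gamma \<phi>2 \<psi>2\<close>. For s
    = False each line goes to the opposite one, so \<open>P2 True\<close> and
    \<open>P2 False\<close> trade places and the inverse appears.\<close>
  have **: "(\<exists>h \<eta>. Ck_diffeo_L k S1 S2 h \<and> homeo0 \<eta> \<and> lifts s \<eta> h) \<longleftrightarrow>
      P2 (\<not> s) \<circ> inv (P2 s) \<in> dcoset k (gamma \<phi>1 \<psi>1)" for s
    unfolding * g1
    by (rule dcoset_iff_intertwiner[symmetric]) (simp_all add: P1_def P2_def h1 h2)
  have lift: "\<exists>s \<eta>. homeo0 \<eta> \<and> lifts s \<eta> h" if "Ck_diffeo_L k S1 S2 h" for h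
    using that homeomorphic_imp_lifts by (simp add: Ck_diffeo_L_def)
  \<comment> \<open>What \<open>h\<close> does to the origins determines \<open>s\<close>, so
    restricting to maps that fix them keeps exactly s = True.\<close>
  have fix_iff: "h orig = orig \<and> h orig' = orig' \<longleftrightarrow> s" if "homeo0 \<eta>" "lifts s \<eta> h" for s \<eta> h
    using that by (auto simp: orig_incl liftsD incl_eq_iff homeo0_def)
  have "diffeomorphic_fix k S1 S2 \<longleftrightarrow> (\<exists>h \<eta>. Ck_diffeo_L k S1 S2 h \<and> homeo0 \<eta> \<and> lifts True \<eta> h)"
    unfolding diffeomorphic_fix_def using lift fix_iff by (metis (full_types))
  then show "diffeomorphic_fix k S1 S2 \<longleftrightarrow> gamma \<phi>2 \<psi>2 \<in> dcoset k (gamma \<phi>1 \<psi>1)"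
    using **[of True] by (simp add: g2)
  have "diffeomorphic k S1 S2 \<longleftrightarrow> (\<exists>s h \<eta>. Ck_diffeo_L k S1 S2 h \<and> homeo0 \<eta> \<and> lifts s \<eta> h)"
    unfolding diffeomorphic_def using lift by blast
  also have "\<dots> \<longleftrightarrow> P2 False \<circ> inv (P2 True) \<in> dcoset k (gamma \<phi>1 \<psi>1) \<or>
      P2 True \<circ> inv (P2 False) \<in> dcoset k (gamma \<phi>1 \<psi>1)"
    unfolding ** by (simp add: ex_bool_eq)
  finally show "diffeomorphic k S1 S2 \<longleftrightarrow>
      gamma \<phi>2 \<psi>2 \<in> dcoset k (gamma \<phi>1 \<psi>1) \<or> inv (gamma \<phi>2 \<psi>2) \<in> dcoset k (gamma \<phi>1 \<psi>1)"
    by (simp only: g2') (simp only: g2)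
qed

section \<open>Values of the invariant\<close>

lemma minimal_atlas_gamma_Hk:
  assumes "minimal_atlas k \<phi> \<psi>"
  shows "gamma \<phi> \<psi> \<in> Hk k"
proof -
  have *: "homeo0 (\<phi> \<circ> incl True)" "homeo0 (\<psi> \<circ> incl False)"
    using assms by (simp_all add: minimal_atlas_iff)
  have "inv (gamma \<phi> \<psi>) = (\<phi> \<circ> incl True) \<circ> inv (\<psi> \<circ> incl False)"
    using * by (simp add: gamma_eq homeo0_inv_comp homeo0_inv homeo0_inv_inv)
  with assms * show ?thesis
    by (simp add: Hk_iff gamma_eq minimal_atlas_iff homeo0_comp homeo0_inv)
qed

text \<open>With the identity as coordinate on the first line and \<open>h\<close> on the second,
  the transition map is \<open>h\<close> itself.\<close>

lemma minimal_atlas_of_Hk: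
  assumes h: "h \<in> Hk k"
  shows "\<exists>S \<phi> \<psi>. is_structure k S \<and> minimal_atlas k \<phi> \<psi> \<and> {(UL, \<phi>), (VL, \<psi>)} \<in> S \<and> gamma \<phi> \<psi> = h"
proof -
  have p: "proj \<circ> incl True = id" "(h \<circ> proj) \<circ> incl False = h" by auto
  have m: "minimal_atlas k proj (h \<circ> proj)"
    unfolding minimal_atlas_iff p using h by (simp add: Hk_iff homeo0_id)
  moreover have "gamma proj (h \<circ> proj) = h"
    using h gamma_eq[of proj "h \<circ> proj"] by (simp add: p Hk_iff homeo0_id)
  moreover obtain S where "is_structure k S" "{(UL, proj), (VL, h \<circ> proj)} \<in> S"
    using structure_of_atlas[of k "{(UL, proj), (VL, h \<circ> proj)}"] m unfolding minimal_atlas_def by blast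
  ultimately show ?thesis by blast
qed

theorem theorem5p13:
  fixes k :: enat
  assumes "k \<ge> 1"
  shows
    \<comment> \<open>the assignment is defined: minimal atlases exist and give elements of H^k\<close>
    "(\<forall>S. is_structure k S \<longrightarrow> (\<exists>\<phi> \<psi>. minimal_atlas k \<phi> \<psi> \<and> {(UL, \<phi>), (VL, \<psi>)} \<in> S)) \<and>
     (\<forall>\<phi> \<psi>. minimal_atlas k \<phi> \<psi> \<longrightarrow> gamma \<phi> \<psi> \<in> Hk k) \<and>
     \<comment> \<open>(1) well-defined and injective on classes modulo diffeomorphism\<close>
     (\<forall>S1 S2 \<phi>1 \<psi>1 \<phi>2 \<psi>2. is_structure k S1 \<and> is_structure k S2 \<and>
        minimal_atlas k \<phi>1 \<psi>1 \<and> {(UL, \<phi>1), (VL, \<psi>1)} \<in> S1 \<and>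
        minimal_atlas k \<phi>2 \<psi>2 \<and> {(UL, \<phi>2), (VL, \<psi>2)} \<in> S2 \<longrightarrow>
        (diffeomorphic k S1 S2 \<longleftrightarrow> pm_dcoset k (gamma \<phi>1 \<psi>1) = pm_dcoset k (gamma \<phi>2 \<psi>2))) \<and>
     \<comment> \<open>(1) surjective onto the (D^k,\<plusminus>)-double cosets\<close>
     (\<forall>h\<in>Hk k. \<exists>S \<phi> \<psi>. is_structure k S \<and> minimal_atlas k \<phi> \<psi> \<and> {(UL, \<phi>), (VL, \<psi>)} \<in> S \<and>
        pm_dcoset k (gamma \<phi> \<psi>) = pm_dcoset k h) \<and>
     \<comment> \<open>(2) well-defined and injective on classes modulo origin-fixing diffeomorphism\<close>
     (\<forall>S1 S2 \<phi>1 \<psi>1 \<phi>2 \<psi>2. is_structure k S1 \<and> is_structure k S2 \<and>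
        minimal_atlas k \<phi>1 \<psi>1 \<and> {(UL, \<phi>1), (VL, \<psi>1)} \<in> S1 \<and>
        minimal_atlas k \<phi>2 \<psi>2 \<and> {(UL, \<phi>2), (VL, \<psi>2)} \<in> S2 \<longrightarrow>
        (diffeomorphic_fix k S1 S2 \<longleftrightarrow> dcoset k (gamma \<phi>1 \<psi>1) = dcoset k (gamma \<phi>2 \<psi>2))) \<and>
     \<comment> \<open>(2) surjective onto the D^k-double cosets\<close>
     (\<forall>h\<in>Hk k. \<exists>S \<phi> \<psi>. is_structure k S \<and> minimal_atlas k \<phi> \<psi> \<and> {(UL, \<phi>), (VL, \<psi>)} \<in> S \<and>
        dcoset k (gamma \<phi> \<psi>) = dcoset k h)"
proof (intro conjI allI impI ballI)
  fix S assume "is_structure k S"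
  then show "\<exists>\<phi> \<psi>. minimal_atlas k \<phi> \<psi> \<and> {(UL, \<phi>), (VL, \<psi>)} \<in> S"
    by (rule minimal_atlas_exists[OF assms])
next
  fix \<phi> \<psi> assume "minimal_atlas k \<phi> \<psi>"
  then show "gamma \<phi> \<psi> \<in> Hk k" by (rule minimal_atlas_gamma_Hk)
next
  fix S1 S2 \<phi>1 \<psi>1 \<phi>2 \<psi>2
  assume *: "is_structure k S1 \<and> is_structure k S2 \<and>
        minimal_atlas k \<phi>1 \<psi>1 \<and> {(UL, \<phi>1), (VL, \<psi>1)} \<in> S1 \<and>
        minimal_atlas k \<phi>2 \<psi>2 \<and> {(UL, \<phi>2), (VL, \<psi>2)} \<in> S2"
  then have "homeo0 (gamma \<phi>1 \<psi>1)" "homeo0 (gamma \<phi>2 \<psi>2)"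
    using minimal_atlas_gamma_Hk Hk_iff by blast+
  then show "diffeomorphic k S1 S2 \<longleftrightarrow> pm_dcoset k (gamma \<phi>1 \<psi>1) = pm_dcoset k (gamma \<phi>2 \<psi>2)"
    using diffeo_classes(2)[of k S1 S2 \<phi>1 \<psi>1 \<phi>2 \<psi>2] * by (simp add: pm_dcoset_eq_iff)
  show "diffeomorphic_fix k S1 S2 \<longleftrightarrow> dcoset k (gamma \<phi>1 \<psi>1) = dcoset k (gamma \<phi>2 \<psi>2)"
    using diffeo_classes(1)[of k S1 S2 \<phi>1 \<psi>1 \<phi>2 \<psi>2] * by (simp add: dcoset_eq_iff)
next
  fix h assume "h \<in> Hk k"
  from minimal_atlas_of_Hk[OF this] obtain S \<phi> \<psi> where
    "is_structure k S" "minimal_atlas k \<phi> \<psi>" "{(UL, \<phi>), (VL, \<psi>)} \<in> S" "gamma \<phi> \<psi> = h"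
    by blast
  then show "\<exists>S \<phi> \<psi>. is_structure k S \<and> minimal_atlas k \<phi> \<psi> \<and> {(UL, \<phi>), (VL, \<psi>)} \<in> S \<and>
        pm_dcoset k (gamma \<phi> \<psi>) = pm_dcoset k h"
    and "\<exists>S \<phi> \<psi>. is_structure k S \<and> minimal_atlas k \<phi> \<psi> \<and> {(UL, \<phi>), (VL, \<psi>)} \<in> S \<and>
        dcoset k (gamma \<phi> \<psi>) = dcoset k h"
    by blast+
qed

end
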